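(* Let $\nu\in(0,1)$ and $\lambda>0$. Let $\{X_n:n\geq 1\}$ be i.i.d. real random variables such that $\mathbb{E}[e^{\theta X_1}]<\infty$ for all $\theta$ in a neighborhood of $0$, and let $\{N_{\nu,\lambda}(t):t\geq 0\}$ be a time fractional Poisson process with parameters $\nu,\lambda$, independent of $\{X_n:n\geq 1\}$. Set $S_{\nu,\lambda}(t):=\sum_{k=1}^{N_{\nu,\lambda}(t)}X_k$ for $t\geq 0$. Let $\Lambda_{\nu,\lambda}:\mathbb{R}\to[0,\infty]$ be defined by $$\Lambda_{\nu,\lambda}(\theta):=\begin{cases}(\lambda(\mathbb{E}[e^{\theta X_1}]-1))^{1/\nu} & \text{if } \mathbb{E}[e^{\theta X_1}]>1,\\ 0 & \text{if } \mathbb{E}[e^{\theta X_1}]\leq 1,\end{cases}$$ (with value $+\infty$ when $\mathbb{E}[e^{\theta X_1}]=\infty$), and assume that $\Lambda_{\nu,\lambda}$ is essentially smooth. Then, as $t\to\infty$, the family $\left\{\frac{S_{\nu,\lambda}(t)}{t}:t>0\right\}$ satisfies the large deviation principle with speed $v_t=t$ and good rate function $I_{\mathrm{LD}}$ defined by $$I_{\mathrm{LD}}(x):=\sup_{\theta\in\mathbb{R}}\{\theta x-\Lambda_{\nu,\lambda}(\theta)\},\qquad x\in\mathbb{R}.$$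
   Context: Time fractional Poisson process: for $\nu\in(0,1)$ and $\lambda>0$, $N_{\nu,\lambda}(t)=N_{1,\lambda}(L_\nu(t))$ for all $t\geq 0$, where $\{N_{1,\lambda}(t):t\geq 0\}$ is a standard (homogeneous) Poisson process with rate $\lambda$ and $\{L_\nu(t):t\geq 0\}$ is an independent inverse of the stable subordinator, i.e. $L_\nu(t)=\inf\{s\geq 0: D_\nu(s)>t\}$, where $\{D_\nu(s):s\geq 0\}$ is the $\nu$-stable subordinator with $\mathbb{E}[e^{-\xi D_\nu(s)}]=e^{-s\xi^\nu}$ for $\xi\geq 0$. With this normalization $\mathbb{E}[e^{\theta L_\nu(t)}]=E_\nu(\theta t^\nu)$ for all $\theta\in\mathbb{R}$, where $E_\nu(x):=\sum_{k=0}^\infty\frac{x^k}{\Gamma(\nu k+1)}$ is the Mittag-Leffler function. An empty sum is $0$. Large deviation principle (LDP): a speed function is a family $\{v_t:t>0\}$ of numbers with $v_t\to\infty$ as $t\to\infty$; a rate function is a lower semicontinuous function $I:\mathbb{R}\to[0,\infty]$. A family $\{Z_t:t>0\}$ of real random variables satisfies the LDP with speed $v_t$ and rate function $I$ if $\limsup_{t\to\infty}\frac{1}{v_t}\log P(Z_t\in C)\leq-\inf_{x\in C}I(x)$ for all closed sets $C\subseteq\mathbb{R}$ and $\liminf_{t\to\infty}\frac{1}{v_t}\log P(Z_t\in O)\geq-\inf_{x\in O}I(x)$ for all open sets $O\subseteq\mathbb{R}$. The rate function $I$ is good if the level set $\{x\in\mathbb{R}:I(x)\leq\beta\}$ is compact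 for every $\beta\geq 0$. Essential smoothness: for $\Lambda:\mathbb{R}\to(-\infty,\infty]$ let $\mathcal{D}(\Lambda):=\{\theta\in\mathbb{R}:\Lambda(\theta)<\infty\}$. $\Lambda$ is essentially smooth if the interior of $\mathcal{D}(\Lambda)$ is non-empty, $\Lambda$ is differentiable throughout the interior of $\mathcal{D}(\Lambda)$, and $\Lambda$ is steep, i.e. $|\Lambda'(\theta_n)|\to\infty$ whenever $\{\theta_n\}$ is a sequence of points in the interior of $\mathcal{D}(\Lambda)$ converging to a boundary point of $\mathcal{D}(\Lambda)$. *)

theory Defs
  imports "HOL-Probability.Probability"
begin

section \<open>Stochastic processes indexed by nonnegative time\<close>

definition process_sigma ::
  "'a measure \<Rightarrow> 'i set \<Rightarrow> 'b measure \<Rightarrow> ('i \<Rightarrow> 'a \<Rightarrow> 'b) \<Rightarrow> 'a set set" where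
  "process_sigma M I S Y = sigma_sets (space M) (\<Union>i\<in>I. {Y i -` A \<inter> space M | A. A \<in> sets S})"

text \<open>The library's \<open>indep_var\<close> forces both sides to have the same value type,
  so independence of two processes is expressed through the generated sigma-algebras.\<close>

definition indep_processes ::
  "'a measure \<Rightarrow> 'i set \<Rightarrow> 'b measure \<Rightarrow> ('i \<Rightarrow> 'a \<Rightarrow> 'b)
     \<Rightarrow> 'j set \<Rightarrow> 'c measure \<Rightarrow> ('j \<Rightarrow> 'a \<Rightarrow> 'c) \<Rightarrow> bool" where
  "indep_processes M I S Y J T Z \<longleftrightarrow>
     prob_space.indep_set M (process_sigma M I S Y) (process_sigma M J T Z)"

definition independent_increments :: "'a measure \<Rightarrow> (real \<Rightarrow> 'a \<Rightarrow> real) \<Rightarrow> bool" where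
  "independent_increments M Y \<longleftrightarrow>
     (\<forall>(n::nat) (t::nat \<Rightarrow> real). 0 \<le> t 0 \<and> (\<forall>i<n. t i \<le> t (Suc i)) \<longrightarrow>
        prob_space.indep_vars M (\<lambda>_. borel) (\<lambda>i \<omega>. Y (t (Suc i)) \<omega> - Y (t i) \<omega>) {..<n})"

definition stationary_increments :: "'a measure \<Rightarrow> (real \<Rightarrow> 'a \<Rightarrow> real) \<Rightarrow> bool" where
  "stationary_increments M Y \<longleftrightarrow>
     (\<forall>s\<ge>0. \<forall>t\<ge>0. distr M borel (\<lambda>\<omega>. Y (s + t) \<omega> - Y s \<omega>) = distr M borel (Y t))"

text \<open>Left limits are automatic for nondecreasing paths, so cadlag reduces to right-continuity.
  Path properties are only required almost surely.\<close>

definition subordinator :: "'a measure \<Rightarrow> (real \<Rightarrow> 'a \<Rightarrow> real) \<Rightarrow> bool" where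
  "subordinator M Y \<longleftrightarrow>
     (\<forall>t\<ge>0. Y t \<in> borel_measurable M) \<and>
     (AE \<omega> in M. Y 0 \<omega> = 0) \<and>
     independent_increments M Y \<and>
     stationary_increments M Y \<and>
     (AE \<omega> in M. mono_on {0..} (\<lambda>t. Y t \<omega>) \<and>
        (\<forall>t\<ge>0. ((\<lambda>s. Y s \<omega>) \<longlongrightarrow> Y t \<omega>) (at_right t)))"

text \<open>The case \<open>t = 0\<close> is excluded in the marginal law because \<open>poisson_pmf\<close> is only
  meaningful for positive parameters; there, \<open>subordinator\<close> gives \<open>P 0 = 0\<close> almost surely.\<close>

definition poisson_process :: "'a measure \<Rightarrow> real \<Rightarrow> (real \<Rightarrow> 'a \<Rightarrow> nat) \<Rightarrow> bool" where
  "poisson_process M lam P \<longleftrightarrow>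
     (\<forall>t\<ge>0. P t \<in> measurable M (count_space UNIV)) \<and>
     subordinator M (\<lambda>t \<omega>. real (P t \<omega>)) \<and>
     (\<forall>t>0. distr M (count_space UNIV) (P t) = measure_pmf (poisson_pmf (lam * t)))"

definition stable_subordinator :: "'a measure \<Rightarrow> real \<Rightarrow> (real \<Rightarrow> 'a \<Rightarrow> real) \<Rightarrow> bool" where
  "stable_subordinator M \<nu> D \<longleftrightarrow>
     subordinator M D \<and>
     (\<forall>s\<ge>0. \<forall>\<xi>\<ge>0. prob_space.expectation M (\<lambda>\<omega>. exp (- \<xi> * D s \<omega>)) = exp (- s * \<xi> powr \<nu>))"

text \<open>The defining identity holds almost surely, simultaneously in \<open>t\<close>: on the null event where
  a path of \<open>D\<close> is bounded, the set below may be empty and its real infimum is then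
  meaningless.\<close>

definition inverse_stable_subordinator ::
  "'a measure \<Rightarrow> real \<Rightarrow> (real \<Rightarrow> 'a \<Rightarrow> real) \<Rightarrow> bool" where
  "inverse_stable_subordinator M \<nu> L \<longleftrightarrow>
     (\<forall>t\<ge>0. L t \<in> borel_measurable M) \<and>
     (\<exists>D. stable_subordinator M \<nu> D \<and>
        (AE \<omega> in M. \<forall>t\<ge>0. L t \<omega> = Inf {s. 0 \<le> s \<and> t < D s \<omega>}))"

definition time_fractional_poisson_process ::
  "'a measure \<Rightarrow> real \<Rightarrow> real \<Rightarrow> (real \<Rightarrow> 'a \<Rightarrow> nat) \<Rightarrow> bool" where
  "time_fractional_poisson_process M \<nu> lam N \<longleftrightarrow>
     (\<forall>t\<ge>0. N t \<in> measurable M (count_space UNIV)) \<and>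
     (\<exists>P L. poisson_process M lam P \<and>
        inverse_stable_subordinator M \<nu> L \<and>
        indep_processes M {0..} (count_space UNIV) P {0..} borel L \<and>
        (AE \<omega> in M. \<forall>t\<ge>0. N t \<omega> = P (L t \<omega>) \<omega>))"

section \<open>Large deviation principle\<close>

text \<open>Needed because the library's real logarithm satisfies \<open>ln 0 = 0\<close>.\<close>

definition log_prob :: "real \<Rightarrow> ereal" where
  "log_prob p = (if p = 0 then -\<infinity> else ereal (ln p))"

definition lower_semicontinuous :: "(real \<Rightarrow> ereal) \<Rightarrow> bool" where
  "lower_semicontinuous I \<longleftrightarrow> (\<forall>x. I x \<le> Liminf (at x) I)"

definition speed_function :: "(real \<Rightarrow> real) \<Rightarrow> bool" where
  "speed_function v \<longleftrightarrow> filterlim v at_top at_top"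

definition rate_function :: "(real \<Rightarrow> ereal) \<Rightarrow> bool" where
  "rate_function I \<longleftrightarrow> lower_semicontinuous I \<and> (\<forall>x. 0 \<le> I x)"

definition good_rate_function :: "(real \<Rightarrow> ereal) \<Rightarrow> bool" where
  "good_rate_function I \<longleftrightarrow>
     rate_function I \<and> (\<forall>\<beta>::real. 0 \<le> \<beta> \<longrightarrow> compact {x. I x \<le> ereal \<beta>})"

definition satisfies_LDP ::
  "'a measure \<Rightarrow> (real \<Rightarrow> 'a \<Rightarrow> real) \<Rightarrow> (real \<Rightarrow> real) \<Rightarrow> (real \<Rightarrow> ereal) \<Rightarrow> bool" where
  "satisfies_LDP M Z v I \<longleftrightarrow>
     (\<forall>t>0. Z t \<in> borel_measurable M) \<and>
     speed_function v \<and>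
     rate_function I \<and>
     (\<forall>C. closed C \<longrightarrow>
        Limsup at_top (\<lambda>t. log_prob (measure M {\<omega> \<in> space M. Z t \<omega> \<in> C}) / ereal (v t))
          \<le> - (INF x\<in>C. I x)) \<and>
     (\<forall>G. open G \<longrightarrow>
        - (INF x\<in>G. I x)
          \<le> Liminf at_top (\<lambda>t. log_prob (measure M {\<omega> \<in> space M. Z t \<omega> \<in> G}) / ereal (v t)))"

section \<open>Essential smoothness and the limiting cumulant function\<close>

definition effective_domain :: "(real \<Rightarrow> ereal) \<Rightarrow> real set" where
  "effective_domain F = {\<theta>. F \<theta> < \<infinity>}"

text \<open>\<open>real_of_ereal\<close> sends \<open>\<infinity>\<close> to \<open>0\<close>, which is harmless here: derivatives are
  taken only at interior points of the effective domain, near which \<open>F\<close> is finite.\<close>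

definition essentially_smooth :: "(real \<Rightarrow> ereal) \<Rightarrow> bool" where
  "essentially_smooth F \<longleftrightarrow>
     (\<forall>\<theta>. F \<theta> \<noteq> -\<infinity>) \<and>
     interior (effective_domain F) \<noteq> {} \<and>
     (\<forall>\<theta>\<in>interior (effective_domain F). (\<lambda>x. real_of_ereal (F x)) differentiable (at \<theta>)) \<and>
     (\<forall>(\<theta>::nat \<Rightarrow> real) b.
        (\<forall>n. \<theta> n \<in> interior (effective_domain F)) \<and> b \<in> frontier (effective_domain F) \<and>
        \<theta> \<longlonglongrightarrow> b \<longrightarrow>
        filterlim (\<lambda>n. \<bar>deriv (\<lambda>x. real_of_ereal (F x)) (\<theta> n)\<bar>) at_top sequentially)"

definition moment_gen :: "'a measure \<Rightarrow> ('a \<Rightarrow> real) \<Rightarrow> real \<Rightarrow> ennreal" where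
  "moment_gen M Y \<theta> = (\<integral>\<^sup>+ \<omega>. ennreal (exp (\<theta> * Y \<omega>)) \<partial>M)"

definition Lambda_frac ::
  "'a measure \<Rightarrow> real \<Rightarrow> real \<Rightarrow> ('a \<Rightarrow> real) \<Rightarrow> real \<Rightarrow> ereal" where
  "Lambda_frac M \<nu> lam Y \<theta> =
     (if moment_gen M Y \<theta> = \<infinity> then \<infinity>
      else if moment_gen M Y \<theta> > 1
      then ereal ((lam * (enn2real (moment_gen M Y \<theta>) - 1)) powr (1 / \<nu>))
      else 0)"

definition legendre_transform :: "(real \<Rightarrow> ereal) \<Rightarrow> real \<Rightarrow> ereal" where
  "legendre_transform F x = (SUP \<theta>. ereal (\<theta> * x) - F \<theta>)"

end

theory Submission
  imports Defs "HOL-Real_Asymp.Real_Asymp"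
begin

text \<open>The scaled cumulants of \<open>S t\<close> converge to \<open>\<Lambda>\<close>, and a one-dimensional Gaertner-Ellis theorem
  applies. The Mittag-Leffler function is avoided: conditioning gives \<open>E exp (\<theta> S t) = E m^N t\<close> with
  \<open>m = E exp (\<theta> X)\<close>, and since Poisson paths are monotone, replacing the random time \<open>L t\<close> by a
  neighbouring integer shows that this agrees with \<open>E exp (c L t)\<close>, \<open>c = lam (m - 1)\<close>, up to a
  factor independent of \<open>t\<close>. The exponential rate of \<open>E exp (c L t)\<close> follows from the duality of
  \<open>L t > s\<close> and \<open>D s \<le> t\<close>: the Chernoff bound for \<open>P (D s \<le> t)\<close> gives the upper estimate, and
  exponential tilting of \<open>D (\<kappa> t)\<close> the lower one.

  In the Gaertner-Ellis lower bound, a point that is not a slope of \<open>\<Lambda>\<close> is approximated by slopes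
  without increasing the rate; steepness and the intermediate value property of derivatives provide
  these slopes.\<close>

section \<open>A one-dimensional Gaertner-Ellis theorem\<close>

lemma (in prob_space) expectation_exp_pos:
  fixes f :: "'a \<Rightarrow> real"
  assumes "integrable M (\<lambda>\<omega>. exp (f \<omega>))"
  shows "0 < expectation (\<lambda>\<omega>. exp (f \<omega>))"
proof -
  have "expectation (\<lambda>\<omega>. exp (f \<omega>)) \<noteq> 0"
    using integral_nonneg_eq_0_iff_AE[OF assms] by (auto simp: not_le AE_False)
  moreover have "0 \<le> expectation (\<lambda>\<omega>. exp (f \<omega>))"
    by (rule Bochner_Integration.integral_nonneg) simp
  ultimately show ?thesis by linarith
qed

lemma (in prob_space) cumulant_limit_bounds:
  fixes Z :: "real \<Rightarrow> 'a \<Rightarrow> real"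
  assumes int: "\<forall>\<^sub>F t in at_top. integrable M (\<lambda>\<omega>. exp (\<theta> * Z t \<omega>))"
    and lim: "((\<lambda>t. ln (expectation (\<lambda>\<omega>. exp (\<theta> * Z t \<omega>))) / t) \<longlongrightarrow> l) at_top"
    and "0 < \<kappa>"
  shows "\<forall>\<^sub>F t in at_top. exp (t * (l - \<kappa>)) < expectation (\<lambda>\<omega>. exp (\<theta> * Z t \<omega>))
    \<and> expectation (\<lambda>\<omega>. exp (\<theta> * Z t \<omega>)) < exp (t * (l + \<kappa>))"
proof -
  have "\<forall>\<^sub>F t in at_top. l - \<kappa> < ln (expectation (\<lambda>\<omega>. exp (\<theta> * Z t \<omega>))) / t"
    "\<forall>\<^sub>F t in at_top. ln (expectation (\<lambda>\<omega>. exp (\<theta> * Z t \<omega>))) / t < l + \<kappa>"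
    using order_tendstoD[OF lim] \<open>0 < \<kappa>\<close> by simp_all
  then show ?thesis using int eventually_gt_at_top[of 0]
  proof eventually_elim
    case (elim t)
    have p: "0 < expectation (\<lambda>\<omega>. exp (\<theta> * Z t \<omega>))"
      by (rule expectation_exp_pos) (rule elim)
    have "t * (l - \<kappa>) < ln (expectation (\<lambda>\<omega>. exp (\<theta> * Z t \<omega>)))"
      "ln (expectation (\<lambda>\<omega>. exp (\<theta> * Z t \<omega>))) < t * (l + \<kappa>)"
      using elim by (auto simp: field_simps)
    then show ?case using p by (metis exp_less_mono exp_ln)
  qed
qed

text \<open>After tilting by \<open>exp (\<theta>0 * Z t)\<close> the variable \<open>Z t / t\<close> concentrates at \<open>\<Lambda>' \<theta>0\<close>.\<close>

lemma (in prob_space) tilted_lower_bound: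
  fixes Z :: "real \<Rightarrow> 'a \<Rightarrow> real" and \<Lambda> :: "real \<Rightarrow> real"
  assumes Z[measurable]: "\<And>t. 0 < t \<Longrightarrow> Z t \<in> borel_measurable M"
    and lim: "\<forall>\<^sub>F \<theta> in nhds \<theta>0. (\<forall>\<^sub>F t in at_top. integrable M (\<lambda>\<omega>. exp (\<theta> * Z t \<omega>))) \<and>
        ((\<lambda>t. ln (expectation (\<lambda>\<omega>. exp (\<theta> * Z t \<omega>))) / t) \<longlongrightarrow> \<Lambda> \<theta>) at_top"
    and deriv: "(\<Lambda> has_real_derivative x0) (at \<theta>0)"
    and "0 < \<delta>" "0 < e"
  shows "\<forall>\<^sub>F t in at_top. exp (- t * (\<theta>0 * x0 - \<Lambda> \<theta>0 + e))
           \<le> prob {\<omega> \<in> space M. \<bar>Z t \<omega> / t - x0\<bar> < \<delta>}"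
proof -
  define d where "d = min \<delta> (e / (4 * (\<bar>\<theta>0\<bar> + 1)))"
  have d: "0 < d" "d \<le> \<delta>" using \<open>0 < \<delta>\<close> \<open>0 < e\<close> by (auto simp: d_def)
  have "\<bar>\<theta>0\<bar> * d \<le> (\<bar>\<theta>0\<bar> + 1) * (e / (4 * (\<bar>\<theta>0\<bar> + 1)))"
    using \<open>0 < d\<close> by (intro mult_mono) (auto simp: d_def)
  also have "\<dots> = e / 4" using abs_ge_zero[of \<theta>0] by (simp add: divide_simps)
  finally have \<theta>d: "\<bar>\<theta>0\<bar> * d \<le> e / 4" .
  obtain r where r: "0 < r" "\<And>\<theta>. dist \<theta> \<theta>0 < r \<Longrightarrow>
      (\<forall>\<^sub>F t in at_top. integrable M (\<lambda>\<omega>. exp (\<theta> * Z t \<omega>))) \<and>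
      ((\<lambda>t. ln (expectation (\<lambda>\<omega>. exp (\<theta> * Z t \<omega>))) / t) \<longlongrightarrow> \<Lambda> \<theta>) at_top"
    using lim unfolding eventually_nhds_metric by blast
  have dp: "((\<lambda>h. \<Lambda> (\<theta>0 + h) - h * (x0 + d / 2)) has_real_derivative - (d / 2)) (at 0)"
    using deriv by (auto intro!: derivative_eq_intros DERIV_chain2[where f=\<Lambda>])
  have dm: "((\<lambda>h. \<Lambda> (\<theta>0 - h) + h * (x0 - d / 2)) has_real_derivative - (d / 2)) (at 0)"
    using deriv by (auto intro!: derivative_eq_intros DERIV_chain2[where f=\<Lambda>])
  obtain r1 where r1: "0 < r1" "\<And>h. 0 < h \<Longrightarrow> h < r1 \<Longrightarrow> \<Lambda> (\<theta>0 + h) - h * (x0 + d / 2) < \<Lambda> \<theta>0"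
    using DERIV_neg_dec_right[OF dp] \<open>0 < d\<close> by auto
  obtain r2 where r2: "0 < r2" "\<And>h. 0 < h \<Longrightarrow> h < r2 \<Longrightarrow> \<Lambda> (\<theta>0 - h) + h * (x0 - d / 2) < \<Lambda> \<theta>0"
    using DERIV_neg_dec_right[OF dm] \<open>0 < d\<close> by auto
  define \<eta> where "\<eta> = min r (min r1 r2) / 2"
  have \<eta>: "0 < \<eta>" "\<eta> < r" "\<eta> < r1" "\<eta> < r2" using r r1 r2 by (auto simp: \<eta>_def min_def)
  have Lp: "\<Lambda> (\<theta>0 + \<eta>) < \<Lambda> \<theta>0 + \<eta> * (x0 + d / 2)" using r1(2)[of \<eta>] \<eta> by simp
  have Lm: "\<Lambda> (\<theta>0 - \<eta>) < \<Lambda> \<theta>0 - \<eta> * (x0 - d / 2)" using r2(2)[of \<eta>] \<eta> by simp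
  define \<kappa> where "\<kappa> = min (e / 4) (\<eta> * d / 8)"
  have \<kappa>: "0 < \<kappa>" "\<kappa> \<le> e / 4" "\<kappa> \<le> \<eta> * d / 8" using \<eta> d \<open>0 < e\<close> by (auto simp: \<kappa>_def)
  define E where "E \<theta> t = expectation (\<lambda>\<omega>. exp (\<theta> * Z t \<omega>))" for \<theta> t
  have ev: "\<forall>\<^sub>F t in at_top. integrable M (\<lambda>\<omega>. exp (\<theta> * Z t \<omega>)) \<and>
      exp (t * (\<Lambda> \<theta> - \<kappa>)) < E \<theta> t \<and> E \<theta> t < exp (t * (\<Lambda> \<theta> + \<kappa>))"
    if "\<theta> \<in> {\<theta>0, \<theta>0 + \<eta>, \<theta>0 - \<eta>}" for \<theta>
  proof -
    have "dist \<theta> \<theta>0 < r" using that \<eta> r by (auto simp: dist_real_def)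
    from r(2)[OF this] cumulant_limit_bounds[of \<theta> Z "\<Lambda> \<theta>" \<kappa>] \<kappa>(1) show ?thesis
      unfolding E_def by (auto elim: eventually_elim2)
  qed
  have big: "\<forall>\<^sub>F t in at_top. ln 4 \<le> t * (\<eta> * d / 4) \<and> ln 2 \<le> t * (e / 2)"
    using \<eta> d \<open>0 < e\<close> by (intro eventually_conj; real_asymp)
  show ?thesis
    using ev[of \<theta>0, simplified] ev[of "\<theta>0 + \<eta>", simplified] ev[of "\<theta>0 - \<eta>", simplified]
      eventually_gt_at_top[of 0] big
  proof eventually_elim
    case (elim t)
    note [measurable] = Z[OF \<open>0 < t\<close>]
    let ?B = "{\<omega> \<in> space M. \<bar>Z t \<omega> / t - x0\<bar> < d}"
    let ?K = "exp (t * (\<theta>0 * x0 + e / 4))"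
    let ?Kp = "exp (- \<eta> * (x0 + d) * t)" and ?Km = "exp (\<eta> * (x0 - d) * t)"
    have B[measurable]: "?B \<in> events" by measurable
    have pt: "exp (\<theta>0 * Z t \<omega>) \<le> ?K * indicator ?B \<omega>
        + ?Kp * exp ((\<theta>0 + \<eta>) * Z t \<omega>) + ?Km * exp ((\<theta>0 - \<eta>) * Z t \<omega>)"
      if "\<omega> \<in> space M" for \<omega>
    proof -
      consider "\<bar>Z t \<omega> / t - x0\<bar> < d" | "Z t \<omega> \<ge> (x0 + d) * t" | "Z t \<omega> \<le> (x0 - d) * t"
        using \<open>0 < t\<close> by (fastforce simp: field_simps abs_if split: if_splits)
      then show ?thesis
      proof cases
        case 1
        have "\<theta>0 * (Z t \<omega> / t - x0) \<le> \<bar>\<theta>0\<bar> * \<bar>Z t \<omega> / t - x0\<bar>"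
          by (metis abs_ge_self abs_mult)
        also have "\<dots> \<le> \<bar>\<theta>0\<bar> * d" using 1 by (intro mult_left_mono) auto
        finally have "\<theta>0 * (Z t \<omega> / t - x0) \<le> e / 4" using \<theta>d by linarith
        then have "t * (\<theta>0 * (Z t \<omega> / t - x0)) \<le> t * (e / 4)"
          using \<open>0 < t\<close> by (intro mult_left_mono) auto
        moreover have "\<theta>0 * Z t \<omega> = t * (\<theta>0 * (Z t \<omega> / t - x0)) + t * (\<theta>0 * x0)"
          using \<open>0 < t\<close> by (simp add: field_simps)
        ultimately have "\<theta>0 * Z t \<omega> \<le> t * (\<theta>0 * x0 + e / 4)"
          unfolding distrib_left by linarith
        then have "exp (\<theta>0 * Z t \<omega>) \<le> ?K" by simp
        then show ?thesis using 1 that by (simp add: add_nonneg_nonneg add_increasing2)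
      next
        case 2
        have "\<eta> * ((x0 + d) * t) \<le> \<eta> * Z t \<omega>" using 2 \<eta> by (intro mult_left_mono) auto
        then have "exp (\<theta>0 * Z t \<omega>) \<le> ?Kp * exp ((\<theta>0 + \<eta>) * Z t \<omega>)"
          unfolding exp_add[symmetric] by (simp add: algebra_simps)
        then show ?thesis by (simp add: add_increasing add_increasing2)
      next
        case 3
        have "\<eta> * Z t \<omega> \<le> \<eta> * ((x0 - d) * t)" using 3 \<eta> by (intro mult_left_mono) auto
        then have "exp (\<theta>0 * Z t \<omega>) \<le> ?Km * exp ((\<theta>0 - \<eta>) * Z t \<omega>)"
          unfolding exp_add[symmetric] by (simp add: algebra_simps)
        then show ?thesis by (simp add: add_increasing add_increasing2)
      qed
    qed
    have "E \<theta>0 t \<le> expectation (\<lambda>\<omega>. ?K * indicator ?B \<omega>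
        + ?Kp * exp ((\<theta>0 + \<eta>) * Z t \<omega>) + ?Km * exp ((\<theta>0 - \<eta>) * Z t \<omega>))"
      unfolding E_def using elim pt
      by (intro integral_mono Bochner_Integration.integrable_add integrable_mult_right
          integrable_real_indicator) (auto simp: emeasure_eq_measure)
    also have "\<dots> = ?K * prob ?B + ?Kp * E (\<theta>0 + \<eta>) t + ?Km * E (\<theta>0 - \<eta>) t"
      unfolding E_def using elim by (simp add: emeasure_eq_measure)
    finally have main: "E \<theta>0 t \<le> ?K * prob ?B + ?Kp * E (\<theta>0 + \<eta>) t + ?Km * E (\<theta>0 - \<eta>) t" .
    have exp4: "4 * exp y \<le> exp z" if "ln 4 \<le> z - y" for y z :: real
      using that by (metis exp_ln exp_add exp_le_cancel_iff le_diff_eq zero_less_numeral)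
    have exp2: "exp y \<le> exp z / 2" if "ln 2 \<le> z - y" for y z :: real
    proof -
      have "exp (ln 2 + y) \<le> exp z" using that by simp
      then show ?thesis by (simp add: exp_add)
    qed
    have "t * \<kappa> \<le> t * (\<eta> * d / 8)" using \<kappa> \<open>0 < t\<close> by (intro mult_left_mono) auto
    note t\<kappa> = this
    have tp: "t * \<Lambda> (\<theta>0 + \<eta>) \<le> t * (\<Lambda> \<theta>0 + \<eta> * (x0 + d / 2))"
      using Lp \<open>0 < t\<close> by (intro mult_left_mono) auto
    have tm: "t * \<Lambda> (\<theta>0 - \<eta>) \<le> t * (\<Lambda> \<theta>0 - \<eta> * (x0 - d / 2))"
      using Lm \<open>0 < t\<close> by (intro mult_left_mono) auto
    have "?Kp * E (\<theta>0 + \<eta>) t \<le> ?Kp * exp (t * (\<Lambda> (\<theta>0 + \<eta>) + \<kappa>))"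
      using elim by (intro mult_left_mono) auto
    moreover have "4 * (?Kp * exp (t * (\<Lambda> (\<theta>0 + \<eta>) + \<kappa>))) \<le> exp (t * (\<Lambda> \<theta>0 - \<kappa>))"
      unfolding exp_add[symmetric] using t\<kappa> tp elim(5)
      by (intro exp4) (simp add: algebra_simps)
    moreover have "?Km * E (\<theta>0 - \<eta>) t \<le> ?Km * exp (t * (\<Lambda> (\<theta>0 - \<eta>) + \<kappa>))"
      using elim by (intro mult_left_mono) auto
    moreover have "4 * (?Km * exp (t * (\<Lambda> (\<theta>0 - \<eta>) + \<kappa>))) \<le> exp (t * (\<Lambda> \<theta>0 - \<kappa>))"
      unfolding exp_add[symmetric] using t\<kappa> tm elim(5)
      by (intro exp4) (simp add: algebra_simps)
    ultimately have KB: "exp (t * (\<Lambda> \<theta>0 - \<kappa>)) / 2 \<le> ?K * prob ?B"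
      using main elim(1) by linarith
    have "t * \<kappa> \<le> t * (e / 4)" using \<kappa> \<open>0 < t\<close> by (intro mult_left_mono) auto
    then have "?K * exp (- t * (\<theta>0 * x0 - \<Lambda> \<theta>0 + e)) \<le> exp (t * (\<Lambda> \<theta>0 - \<kappa>)) / 2"
      unfolding exp_add[symmetric] using elim(5)
      by (intro exp2) (simp add: algebra_simps)
    then have "?K * exp (- t * (\<theta>0 * x0 - \<Lambda> \<theta>0 + e)) \<le> ?K * prob ?B" using KB by linarith
    then have "exp (- t * (\<theta>0 * x0 - \<Lambda> \<theta>0 + e)) \<le> prob ?B" by simp
    also have "prob ?B \<le> prob {\<omega> \<in> space M. \<bar>Z t \<omega> / t - x0\<bar> < \<delta>}"
      using d by (intro finite_measure_mono) auto
    finally show ?case .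
  qed
qed

lemma derivative_intermediate_value:
  fixes f f' :: "real \<Rightarrow> real"
  assumes "a \<le> b" and deriv: "\<And>u. a \<le> u \<Longrightarrow> u \<le> b \<Longrightarrow> (f has_real_derivative f' u) (at u)"
    and "f' a \<le> x" "x \<le> f' b"
  shows "\<exists>u\<in>{a..b}. f' u = x"
proof (cases "f' a = x \<or> f' b = x")
  case True
  then show ?thesis using \<open>a \<le> b\<close> by auto
next
  case False
  define g where "g u = f u - x * u" for u
  have g: "(g has_real_derivative f' u - x) (at u)" if "a \<le> u" "u \<le> b" for u
    unfolding g_def using deriv[OF that] by (auto intro!: derivative_eq_intros)
  have "continuous_on {a..b} g"
    using g by (intro continuous_at_imp_continuous_on ballI DERIV_isCont) auto
  then obtain u where u: "u \<in> {a..b}" "\<And>v. v \<in> {a..b} \<Longrightarrow> g u \<le> g v"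
    using continuous_attains_inf[of "{a..b}" g] \<open>a \<le> b\<close> by (auto simp del: atLeastAtMost_iff)
  have "a < b" using False assms(3,4) \<open>a \<le> b\<close> by (cases "a = b") auto
  have "u \<noteq> a"
  proof
    assume "u = a"
    obtain d where d: "0 < d" "\<And>h. 0 < h \<Longrightarrow> h < d \<Longrightarrow> g (a + h) < g a"
      using DERIV_neg_dec_right[OF g[of a]] False assms(3) \<open>a \<le> b\<close> by auto
    define h where "h = min d (b - a) / 2"
    have "0 < h" "h < d" "a + h \<le> b" using d \<open>a < b\<close> by (auto simp: h_def min_def field_simps)
    then show False using d(2)[of h] u(2)[of "a + h"] \<open>u = a\<close> by auto
  qed
  moreover have "u \<noteq> b"
  proof
    assume "u = b"
    obtain d where d: "0 < d" "\<And>h. 0 < h \<Longrightarrow> h < d \<Longrightarrow> g (b - h) < g b"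
      using DERIV_pos_inc_left[OF g[of b]] False assms(4) \<open>a \<le> b\<close> by auto
    define h where "h = min d (b - a) / 2"
    have "0 < h" "h < d" "a \<le> b - h" using d \<open>a < b\<close> by (auto simp: h_def min_def field_simps)
    then show False using d(2)[of h] u(2)[of "b - h"] \<open>u = b\<close> by auto
  qed
  ultimately have "a < u" "u < b" using u by auto
  have "f' u - x = 0"
  proof (rule DERIV_local_min)
    show "(g has_real_derivative f' u - x) (at u)" using \<open>a < u\<close> \<open>u < b\<close> by (intro g) auto
    show "0 < min (u - a) (b - u)" using \<open>a < u\<close> \<open>u < b\<close> by simp
    show "\<forall>y. \<bar>u - y\<bar> < min (u - a) (b - u) \<longrightarrow> g u \<le> g y" by (auto intro!: u(2))
  qed
  then show ?thesis using u by auto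
qed

lemma slope_approximation:
  fixes f f' :: "real \<Rightarrow> real"
  assumes "convex U" "0 \<in> U"
    and deriv: "\<And>\<theta>. \<theta> \<in> U \<Longrightarrow> (f has_real_derivative f' \<theta>) (at \<theta>)"
    and steep: "\<And>\<theta> c. 0 \<le> \<theta> \<Longrightarrow> \<theta> \<notin> U \<Longrightarrow> \<exists>\<theta>\<in>U. 0 \<le> \<theta> \<and> c \<le> f' \<theta>"
    and bound: "\<And>\<theta>. \<theta> \<in> U \<Longrightarrow> \<theta> * x - f \<theta> \<le> B"
    and "f' 0 \<le> x" "0 < \<epsilon>"
  shows "\<exists>\<theta>\<in>U. 0 \<le> \<theta> \<and> x - \<epsilon> < f' \<theta> \<and> f' \<theta> \<le> x"
proof (cases "\<exists>\<theta>\<in>U. 0 \<le> \<theta> \<and> x \<le> f' \<theta>")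
  case True
  then obtain \<theta> where \<theta>: "\<theta> \<in> U" "0 \<le> \<theta>" "x \<le> f' \<theta>" by auto
  have sub: "{0..\<theta>} \<subseteq> U"
    using mem_is_interval_1_I[of U 0 \<theta>] assms(1,2) \<theta> by (auto simp: is_interval_convex_1)
  have "(f has_real_derivative f' u) (at u)" if "0 \<le> u" "u \<le> \<theta>" for u
    using deriv sub that by auto
  then obtain u where "u \<in> {0..\<theta>}" "f' u = x"
    using derivative_intermediate_value[of 0 \<theta> f f' x] \<theta> \<open>f' 0 \<le> x\<close> by blast
  then show ?thesis using sub \<open>0 < \<epsilon>\<close> by (intro bexI[of _ u]) auto
next
  case False
  then have lt: "f' \<theta> < x" if "\<theta> \<in> U" "0 \<le> \<theta>" for \<theta> using that by force
  have U: "\<theta> \<in> U" if "0 \<le> \<theta>" for \<theta> using steep[OF that, of x] False by blast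
  have "\<exists>\<theta>\<ge>0. x - \<epsilon> < f' \<theta>"
  proof (rule ccontr)
    assume "\<not> ?thesis"
    then have le: "f' \<theta> \<le> x - \<epsilon>" if "0 \<le> \<theta>" for \<theta> using that by force
    define T where "T = (\<bar>B\<bar> + \<bar>f 0\<bar> + 1) / \<epsilon>"
    have "0 \<le> T" using \<open>0 < \<epsilon>\<close> by (simp add: T_def)
    have "f T - (x - \<epsilon>) * T \<le> f 0 - (x - \<epsilon>) * 0"
    proof (rule DERIV_nonpos_imp_nonincreasing[OF \<open>0 \<le> T\<close>])
      fix u assume "0 \<le> u" "u \<le> T"
      then have "((\<lambda>u. f u - (x - \<epsilon>) * u) has_real_derivative f' u - (x - \<epsilon>)) (at u)"
        using deriv[OF U] by (auto intro!: derivative_eq_intros)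
      then show "\<exists>y. ((\<lambda>u. f u - (x - \<epsilon>) * u) has_real_derivative y) (at u) \<and> y \<le> 0"
        using le[OF \<open>0 \<le> u\<close>] by (intro exI conjI) auto
    qed
    then have "\<epsilon> * T - f 0 \<le> B" using bound[OF U[OF \<open>0 \<le> T\<close>]] by (simp add: algebra_simps)
    moreover have "\<epsilon> * T = \<bar>B\<bar> + \<bar>f 0\<bar> + 1" using \<open>0 < \<epsilon>\<close> by (simp add: T_def)
    ultimately show False by linarith
  qed
  then show ?thesis using lt U by (meson less_imp_le)
qed

lemma steep_derivative_unbounded:
  fixes \<Lambda> :: "real \<Rightarrow> ereal" and \<sigma> :: real
  defines "D \<equiv> effective_domain \<Lambda>" and "f \<equiv> \<lambda>\<theta>. real_of_ereal (\<Lambda> \<theta>)"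
  assumes smooth: "essentially_smooth \<Lambda>" and cvx: "convex_on D f" and zero: "0 \<in> interior D"
    and \<sigma>: "\<sigma> \<in> {1, -1}" and "0 \<le> r" "\<sigma> * r \<notin> interior D"
  shows "\<exists>\<theta>. \<sigma> * \<theta> \<in> interior D \<and> 0 \<le> \<theta> \<and> c \<le> \<sigma> * deriv f (\<sigma> * \<theta>)"
proof -
  define V where "V = {x. \<sigma> * x \<in> interior D}"
  have "convex D" using cvx by (rule convex_on_imp_convex)
  then have "convex (interior D)" by (rule convex_interior)
  moreover have "V = (\<lambda>x. \<sigma> * x) -` interior D" by (auto simp: V_def)
  ultimately have V: "convex V" "open V"
    by (auto intro!: convex_linear_vimage open_vimage continuous_intros linear_times)
  have "0 \<in> V" "r \<notin> V" using zero assms by (auto simp: V_def)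
  have iv: "u \<in> V" if "0 \<le> u" "u \<le> w" "w \<in> V" for u w
    using mem_is_interval_1_I[of V 0 w] that V(1) \<open>0 \<in> V\<close> by (auto simp: is_interval_convex_1)
  have bdd: "u \<le> r" if "u \<in> V" for u using iv[of r u] that \<open>0 \<le> r\<close> \<open>r \<notin> V\<close> by force
  define s where "s = Sup V"
  have bV: "bdd_above V" using bdd by (auto simp: bdd_above_def)
  have "s \<notin> V"
  proof
    assume "s \<in> V"
    then obtain e where "0 < e" "ball s e \<subseteq> V" using V(2) by (auto simp: open_contains_ball)
    then have "s + e / 2 \<in> V" by (auto simp: dist_real_def)
    then have "s + e / 2 \<le> s" unfolding s_def using bV by (intro cSup_upper)
    then show False using \<open>0 < e\<close> by simp
  qed
  have "0 \<le> s" unfolding s_def using bV \<open>0 \<in> V\<close> by (intro cSup_upper)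
  then have "0 < s" using \<open>s \<notin> V\<close> \<open>0 \<in> V\<close> by (cases "s = 0") auto
  have inV: "u \<in> V" if u: "0 \<le> u" "u < s" for u
  proof -
    obtain w where "w \<in> V" "u < w"
      using less_cSup_iff[of V u] bV \<open>0 \<in> V\<close> u unfolding s_def by auto
    then show ?thesis using iv[of u w] u by auto
  qed
  define w where "w n = s * (1 - 1 / (real n + 2))" for n :: nat
  have w: "0 < w n" "w n < s" for n using \<open>0 < s\<close> by (auto simp: w_def field_simps add_pos_nonneg)
  have wlim: "w \<longlonglongrightarrow> s" unfolding w_def by real_asymp
  have wD: "\<sigma> * w n \<in> interior D" for n using inV[of "w n"] w[of n] by (auto simp: V_def)
  have lim: "(\<lambda>n. \<sigma> * w n) \<longlonglongrightarrow> \<sigma> * s" by (intro tendsto_intros wlim)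
  have "\<sigma> * s \<in> closure (interior D)" unfolding closure_sequential
    using wD lim by (intro exI[of _ "\<lambda>n. \<sigma> * w n"]) auto
  then have "\<sigma> * s \<in> closure D" using closure_mono[OF interior_subset] by blast
  then have "\<sigma> * s \<in> frontier D" using \<open>s \<notin> V\<close> by (simp add: frontier_def V_def)
  moreover have "\<forall>(\<theta>::nat \<Rightarrow> real) b. (\<forall>n. \<theta> n \<in> interior D) \<and> b \<in> frontier D \<and> \<theta> \<longlonglongrightarrow> b \<longrightarrow>
      filterlim (\<lambda>n. \<bar>deriv f (\<theta> n)\<bar>) at_top sequentially"
    using smooth unfolding essentially_smooth_def D_def f_def by blast
  note this[THEN spec, THEN spec, of "\<lambda>n. \<sigma> * w n" "\<sigma> * s"]
  ultimately have "filterlim (\<lambda>n. \<bar>deriv f (\<sigma> * w n)\<bar>) at_top sequentially"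
    using wD lim by blast
  then have "\<forall>\<^sub>F n in sequentially. \<bar>c\<bar> + \<bar>deriv f 0\<bar> + 1 \<le> \<bar>deriv f (\<sigma> * w n)\<bar>"
    unfolding filterlim_at_top by blast
  then obtain n where n: "\<bar>c\<bar> + \<bar>deriv f 0\<bar> + 1 \<le> \<bar>deriv f (\<sigma> * w n)\<bar>"
    using eventually_happens by force
  have tangent: "deriv f a * (b - a) \<le> f b - f a" if "a \<in> interior D" "b \<in> interior D" for a b
  proof (rule convex_on_imp_above_tangent[OF cvx])
    show "connected D" using \<open>convex D\<close> by (rule convex_connected)
    show "b \<in> D" using that interior_subset by blast
    have "f differentiable (at a)"
      using smooth that unfolding essentially_smooth_def D_def f_def by blast
    then have "(f has_field_derivative deriv f a) (at a)"
      by (simp add: DERIV_deriv_iff_real_differentiable)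
    then show "(f has_field_derivative deriv f a) (at a within D)"
      by (rule has_field_derivative_at_within)
  qed (use that in auto)
  have "deriv f 0 * (\<sigma> * w n) \<le> deriv f (\<sigma> * w n) * (\<sigma> * w n)"
    using tangent[OF zero wD[of n]] tangent[OF wD[of n] zero] by simp
  then have "(\<sigma> * deriv f 0) * w n \<le> (\<sigma> * deriv f (\<sigma> * w n)) * w n" by (simp add: ac_simps)
  then have "\<sigma> * deriv f 0 \<le> \<sigma> * deriv f (\<sigma> * w n)"
    using w(1)[of n] by (rule mult_right_le_imp_le)
  then have "c \<le> \<sigma> * deriv f (\<sigma> * w n)" using n \<sigma> by auto
  then show ?thesis using wD[of n] w(1)[of n] by (intro exI[of _ "w n"]) auto
qed

lemma legendre_transform_ge: "ereal (\<theta> * x) - F \<theta> \<le> legendre_transform F x"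
  unfolding legendre_transform_def by (rule SUP_upper) simp

lemma legendre_transform_gt:
  assumes "y < legendre_transform F x"
  obtains \<theta> where "y < ereal (\<theta> * x) - F \<theta>"
  using assms unfolding legendre_transform_def less_SUP_iff by auto

text \<open>Steepness makes the slopes \<open>deriv \<Lambda> \<theta>\<close> dense in the effective domain of the transform. The
  bound \<open>B\<close> survives because \<open>\<theta>\<close> is chosen with \<open>\<theta> * deriv \<Lambda> \<theta> \<le> \<theta> * x\<close>.\<close>

lemma legendre_transform_exposed_approx:
  fixes \<Lambda> :: "real \<Rightarrow> ereal"
  defines "D \<equiv> effective_domain \<Lambda>" and "f \<equiv> \<lambda>\<theta>. real_of_ereal (\<Lambda> \<theta>)"
  assumes smooth: "essentially_smooth \<Lambda>" and cvx: "convex_on D f" and zero: "0 \<in> interior D"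
    and B: "legendre_transform \<Lambda> x \<le> ereal B" and "0 < \<epsilon>"
  shows "\<exists>\<theta>\<in>interior D. \<bar>deriv f \<theta> - x\<bar> < \<epsilon> \<and> \<theta> * deriv f \<theta> - f \<theta> \<le> B"
proof -
  define \<sigma> :: real where "\<sigma> = (if deriv f 0 \<le> x then 1 else - 1)"
  have \<sigma>: "\<sigma> \<in> {1, -1}" by (simp add: \<sigma>_def)
  define V where "V = (\<lambda>x. \<sigma> * x) -` interior D"
  have "convex V" unfolding V_def
    by (intro convex_linear_vimage linear_times convex_interior convex_on_imp_convex[OF cvx])
  have f: "ereal (f \<theta>) = \<Lambda> \<theta>" if "\<theta> \<in> D" for \<theta>
    using that smooth by (auto simp: f_def D_def effective_domain_def essentially_smooth_def ereal_real)
  have le: "\<theta> * x - f \<theta> \<le> B" if "\<theta> \<in> interior D" for \<theta>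
  proof -
    have "\<theta> \<in> D" using that interior_subset by blast
    then have "ereal (\<theta> * x - f \<theta>) \<le> legendre_transform \<Lambda> x"
      using legendre_transform_ge[of \<theta> x \<Lambda>] f[of \<theta>] by (metis ereal_minus(1))
    then show ?thesis using B by (metis order_trans ereal_less_eq(3))
  qed
  have "\<exists>\<theta>\<in>V. 0 \<le> \<theta> \<and> \<sigma> * x - \<epsilon> < \<sigma> * deriv f (\<sigma> * \<theta>) \<and> \<sigma> * deriv f (\<sigma> * \<theta>) \<le> \<sigma> * x"
  proof (rule slope_approximation[where f = "\<lambda>\<theta>. f (\<sigma> * \<theta>)" and B = B])
    show "0 \<in> V" using zero by (simp add: V_def)
  next
    fix \<theta> assume "\<theta> \<in> V"
    then have "f differentiable (at (\<sigma> * \<theta>))"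
      using smooth unfolding essentially_smooth_def D_def f_def V_def by blast
    then have "(f has_real_derivative deriv f (\<sigma> * \<theta>)) (at (\<sigma> * \<theta>))"
      by (simp add: DERIV_deriv_iff_real_differentiable)
    then show "((\<lambda>\<theta>. f (\<sigma> * \<theta>)) has_real_derivative \<sigma> * deriv f (\<sigma> * \<theta>)) (at \<theta>)"
      using DERIV_chain2[OF _ DERIV_cmult_Id[of \<sigma>], of f "deriv f (\<sigma> * \<theta>)" \<theta> UNIV]
      by (simp add: mult.commute)
    show "\<theta> * (\<sigma> * x) - f (\<sigma> * \<theta>) \<le> B"
      using le[of "\<sigma> * \<theta>"] \<open>\<theta> \<in> V\<close> by (simp add: V_def ac_simps)
  next
    fix \<theta> c :: real assume "0 \<le> \<theta>" "\<theta> \<notin> V"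
    then show "\<exists>\<theta>\<in>V. 0 \<le> \<theta> \<and> c \<le> \<sigma> * deriv f (\<sigma> * \<theta>)"
      using steep_derivative_unbounded[OF smooth _ _ \<sigma>, of \<theta> c] cvx zero
      unfolding V_def D_def f_def by auto
  qed (use \<open>convex V\<close> \<open>0 < \<epsilon>\<close> in \<open>auto simp: \<sigma>_def\<close>)
  then obtain u where u: "u \<in> V" "0 \<le> u" "\<sigma> * x - \<epsilon> < \<sigma> * deriv f (\<sigma> * u)"
    "\<sigma> * deriv f (\<sigma> * u) \<le> \<sigma> * x" by auto
  have "\<sigma> * u * deriv f (\<sigma> * u) \<le> \<sigma> * u * x"
    using mult_left_mono[OF u(4) u(2)] by (simp add: ac_simps)
  moreover have "\<sigma> * u * x - f (\<sigma> * u) \<le> B" using le[of "\<sigma> * u"] u(1) by (simp add: V_def)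
  moreover have "\<bar>deriv f (\<sigma> * u) - x\<bar> < \<epsilon>" using u(3,4) \<sigma> \<open>0 < \<epsilon>\<close> by auto
  ultimately show ?thesis using u(1) by (intro bexI[of _ "\<sigma> * u"]) (auto simp: V_def)
qed

lemma lower_semicontinuous_legendre_transform: "lower_semicontinuous (legendre_transform F)"
  unfolding lower_semicontinuous_def le_Liminf_iff
proof safe
  fix x y assume "y < legendre_transform F x"
  then obtain \<theta> where \<theta>: "y < ereal (\<theta> * x) - F \<theta>" by (rule legendre_transform_gt)
  have "\<forall>\<^sub>F z in at x. y < ereal (\<theta> * z) - F \<theta>"
  proof (cases "F \<theta>")
    case (real r)
    have "((\<lambda>z. ereal (\<theta> * z - r)) \<longlongrightarrow> ereal (\<theta> * x - r)) (at x)" by (intro tendsto_intros)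
    then show ?thesis using order_tendstoD(1) \<theta> real by fastforce
  qed (use \<theta> in auto)
  then show "\<forall>\<^sub>F z in at x. y < legendre_transform F z"
    by eventually_elim (rule less_le_trans[OF _ legendre_transform_ge])
qed

lemma good_rate_function_legendre_transform:
  assumes F0: "F 0 = 0" and zero: "0 \<in> interior (effective_domain F)"
  shows "good_rate_function (legendre_transform F)"
  unfolding good_rate_function_def rate_function_def
proof (intro conjI allI impI)
  show "lower_semicontinuous (legendre_transform F)"
    by (rule lower_semicontinuous_legendre_transform)
  show "0 \<le> legendre_transform F x" for x
    using legendre_transform_ge[of 0 x F] F0 by (simp add: zero_ereal_def[symmetric])
next
  fix \<beta> :: real
  define K where "K \<theta> = {x. ereal (\<theta> * x) - F \<theta> \<le> ereal \<beta>}" for \<theta>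
  have "closed (K \<theta>)" for \<theta>
  proof (cases "F \<theta>")
    case (real r)
    then have "K \<theta> = {x. \<theta> * x - r \<le> \<beta>}" by (auto simp: K_def)
    then show ?thesis by (auto intro!: closed_Collect_le continuous_intros)
  qed (auto simp: K_def)
  moreover have lev: "{x. legendre_transform F x \<le> ereal \<beta>} = (\<Inter>\<theta>. K \<theta>)"
    unfolding K_def legendre_transform_def SUP_le_iff by auto
  ultimately have "closed {x. legendre_transform F x \<le> ereal \<beta>}" by auto
  moreover have "bounded {x. legendre_transform F x \<le> ereal \<beta>}"
  proof -
    obtain d where d: "0 < d" "ball 0 d \<subseteq> effective_domain F"
      using zero by (auto simp: mem_interior)
    have fin: "\<exists>R. K (d / 2) \<subseteq> {..R}" "\<exists>R. K (- d / 2) \<subseteq> {R..}"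
    proof -
      have *: "F \<theta> < \<infinity>" if "\<theta> \<in> {d / 2, - d / 2}" for \<theta>
      proof -
        have "\<theta> \<in> ball 0 d" using that d by (auto simp: dist_real_def)
        then show ?thesis using d by (auto simp: effective_domain_def)
      qed
      show "\<exists>R. K (d / 2) \<subseteq> {..R}"
      proof (cases "F (d / 2)")
        case (real r)
        then have "K (d / 2) \<subseteq> {..2 * (\<beta> + r) / d}" using d by (auto simp: K_def field_simps)
        then show ?thesis by blast
      qed (use * in \<open>auto simp: K_def\<close>)
      show "\<exists>R. K (- d / 2) \<subseteq> {R..}"
      proof (cases "F (- d / 2)")
        case (real r)
        then have "K (- d / 2) \<subseteq> {- 2 * (\<beta> + r) / d..}" using d by (auto simp: K_def field_simps)
        then show ?thesis by blast
      qed (use * in \<open>auto simp: K_def\<close>)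
    qed
    then obtain R1 R2 where "K (d / 2) \<subseteq> {..R1}" "K (- d / 2) \<subseteq> {R2..}" by auto
    then have "(\<Inter>\<theta>. K \<theta>) \<subseteq> {R2..R1}" by fastforce
    then show ?thesis unfolding lev using bounded_closed_interval bounded_subset by blast
  qed
  ultimately show "compact {x. legendre_transform F x \<le> ereal \<beta>}"
    by (simp add: compact_eq_bounded_closed)
qed

lemma Limsup_log_prob_le:
  assumes "\<forall>\<^sub>F t in at_top. p t \<le> K * exp (- t * \<alpha>)" and "\<And>t. 0 \<le> p t" and "0 < K"
  shows "Limsup at_top (\<lambda>t. log_prob (p t) / ereal t) \<le> - ereal \<alpha>"
proof -
  have "\<forall>\<^sub>F t in at_top. log_prob (p t) / ereal t \<le> ereal (ln K / t - \<alpha>)"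
    using assms(1) eventually_gt_at_top[of 0]
  proof eventually_elim
    case (elim t)
    show ?case
    proof (cases "p t = 0")
      case False
      then have "0 < p t" using assms(2)[of t] by simp
      then have "ln (p t) \<le> ln (K * exp (- t * \<alpha>))" using elim by simp
      also have "\<dots> = ln K - t * \<alpha>" using \<open>0 < K\<close> by (simp add: ln_mult)
      finally show ?thesis using False \<open>0 < t\<close> by (simp add: log_prob_def field_simps)
    qed (use \<open>0 < t\<close> in \<open>simp add: log_prob_def\<close>)
  qed
  then have "Limsup at_top (\<lambda>t. log_prob (p t) / ereal t)
      \<le> Limsup at_top (\<lambda>t. ereal (ln K / t - \<alpha>))"
    by (rule Limsup_mono)
  also have "((\<lambda>t. ln K / t - \<alpha>) \<longlongrightarrow> - \<alpha>) at_top" by real_asymp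
  then have "Limsup at_top (\<lambda>t. ereal (ln K / t - \<alpha>)) = ereal (- \<alpha>)"
    by (intro lim_imp_Limsup) auto
  finally show ?thesis by simp
qed

lemma Liminf_log_prob_ge:
  assumes "\<forall>\<^sub>F t in at_top. exp (- t * \<alpha>) \<le> p t"
  shows "- ereal \<alpha> \<le> Liminf at_top (\<lambda>t. log_prob (p t) / ereal t)"
proof (rule Liminf_bounded)
  show "\<forall>\<^sub>F t in at_top. - ereal \<alpha> \<le> log_prob (p t) / ereal t"
    using assms eventually_gt_at_top[of 0]
  proof eventually_elim
    case (elim t)
    have "0 < p t" using elim(1) exp_gt_zero by (rule less_le_trans[rotated])
    then have "- t * \<alpha> \<le> ln (p t)" using elim(1) by (simp add: ln_ge_iff)
    then show ?case using \<open>0 < p t\<close> \<open>0 < t\<close> by (simp add: log_prob_def field_simps)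
  qed
qed

lemma (in prob_space) Chernoff_halfspace:
  fixes Z :: "real \<Rightarrow> 'a \<Rightarrow> real"
  assumes Z[measurable]: "\<And>t. 0 < t \<Longrightarrow> Z t \<in> borel_measurable M"
    and int: "\<forall>\<^sub>F t in at_top. integrable M (\<lambda>\<omega>. exp (\<theta> * Z t \<omega>))"
    and lim: "((\<lambda>t. ln (expectation (\<lambda>\<omega>. exp (\<theta> * Z t \<omega>))) / t) \<longlongrightarrow> l) at_top"
    and "\<alpha> < \<alpha>'"
  shows "\<forall>\<^sub>F t in at_top. prob {\<omega> \<in> space M. \<alpha>' < \<theta> * (Z t \<omega> / t) - l} \<le> exp (- t * \<alpha>)"
proof -
  have "0 < \<alpha>' - \<alpha>" using \<open>\<alpha> < \<alpha>'\<close> by simp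
  show ?thesis
    using cumulant_limit_bounds[OF int lim \<open>0 < \<alpha>' - \<alpha>\<close>] int eventually_gt_at_top[of 0]
  proof eventually_elim
    case (elim t)
    note [measurable] = Z[OF \<open>0 < t\<close>]
    let ?A = "{\<omega> \<in> space M. \<alpha>' < \<theta> * (Z t \<omega> / t) - l}"
    have "prob ?A = expectation (indicator ?A)" by simp
    also have "\<dots> \<le> expectation (\<lambda>\<omega>. exp (- t * (\<alpha>' + l)) * exp (\<theta> * Z t \<omega>))"
    proof (rule integral_mono)
      show "integrable M (indicator ?A :: 'a \<Rightarrow> real)"
        by (intro integrable_real_indicator) (auto simp: emeasure_eq_measure)
      show "integrable M (\<lambda>\<omega>. exp (- t * (\<alpha>' + l)) * exp (\<theta> * Z t \<omega>))"
        using elim by simp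
      show "indicator ?A \<omega> \<le> exp (- t * (\<alpha>' + l)) * exp (\<theta> * Z t \<omega>)" for \<omega>
      proof (cases "\<omega> \<in> ?A")
        case True
        then have "t * (\<alpha>' + l) \<le> \<theta> * Z t \<omega>" using \<open>0 < t\<close> by (auto simp: field_simps)
        then show ?thesis using True by (simp add: exp_add[symmetric])
      qed simp
    qed
    also have "\<dots> \<le> exp (- t * (\<alpha>' + l)) * exp (t * (l + (\<alpha>' - \<alpha>)))"
      using elim by simp
    also have "\<dots> = exp (- t * \<alpha>)" by (simp add: exp_add[symmetric] algebra_simps)
    finally show ?case .
  qed
qed

theorem (in prob_space) Gartner_Ellis_real:
  fixes Z :: "real \<Rightarrow> 'a \<Rightarrow> real" and \<Lambda> :: "real \<Rightarrow> ereal"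
  assumes Z[measurable]: "\<And>t. 0 < t \<Longrightarrow> Z t \<in> borel_measurable M"
    and int: "\<And>\<theta>. \<Lambda> \<theta> < \<infinity> \<Longrightarrow> \<forall>\<^sub>F t in at_top. integrable M (\<lambda>\<omega>. exp (\<theta> * Z t \<omega>))"
    and lim: "\<And>\<theta>. \<Lambda> \<theta> < \<infinity> \<Longrightarrow>
      ((\<lambda>t. ln (expectation (\<lambda>\<omega>. exp (\<theta> * Z t \<omega>))) / t) \<longlongrightarrow> real_of_ereal (\<Lambda> \<theta>)) at_top"
    and zero: "0 \<in> interior (effective_domain \<Lambda>)"
    and cvx: "convex_on (effective_domain \<Lambda>) (\<lambda>\<theta>. real_of_ereal (\<Lambda> \<theta>))"
    and smooth: "essentially_smooth \<Lambda>"
  shows "satisfies_LDP M (\<lambda>t \<omega>. Z t \<omega> / t) (\<lambda>t. t) (legendre_transform \<Lambda>)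
       \<and> good_rate_function (legendre_transform \<Lambda>)"
proof -
  let ?I = "legendre_transform \<Lambda>" and ?f = "\<lambda>\<theta>. real_of_ereal (\<Lambda> \<theta>)"
  have \<Lambda>_eq: "\<Lambda> \<theta> = ereal (?f \<theta>)" if "\<Lambda> \<theta> < \<infinity>" for \<theta>
    using that smooth by (auto simp: essentially_smooth_def ereal_real)
  have "\<Lambda> 0 < \<infinity>" using zero interior_subset by (force simp: effective_domain_def)
  have "?f 0 = 0"
    using tendsto_unique[OF _ lim[OF \<open>\<Lambda> 0 < \<infinity>\<close>], of 0] by (simp add: prob_space)
  then have "\<Lambda> 0 = 0" using \<Lambda>_eq[OF \<open>\<Lambda> 0 < \<infinity>\<close>] by (simp add: zero_ereal_def)
  have good: "good_rate_function ?I"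
    by (rule good_rate_function_legendre_transform) (use \<open>\<Lambda> 0 = 0\<close> zero in auto)

  define P where "P t A = prob {\<omega> \<in> space M. Z t \<omega> / t \<in> A}" for t A
  define U where "U \<alpha> \<theta> = {y. \<alpha> < \<theta> * y - ?f \<theta>}" for \<alpha> \<theta>
  have upper: "Limsup at_top (\<lambda>t. log_prob (P t C) / ereal t) \<le> - (INF x\<in>C. ?I x)"
    if "closed C" for C
  proof -
    have bound: "Limsup at_top (\<lambda>t. log_prob (P t C) / ereal t) \<le> - ereal \<alpha>"
      if lt: "ereal \<alpha> < (INF x\<in>C. ?I x)" for \<alpha>
    proof -
      obtain \<alpha>' where \<alpha>': "\<alpha> < \<alpha>'" "ereal \<alpha>' < (INF x\<in>C. ?I x)"
        using ereal_dense2[OF lt] by auto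
      have cov: "\<exists>\<theta>. \<Lambda> \<theta> < \<infinity> \<and> x \<in> U \<alpha>' \<theta>" if "x \<in> C" for x
      proof -
        have "ereal \<alpha>' < ?I x" using \<alpha>'(2) that by (metis INF_lower less_le_trans)
        then obtain \<theta> where \<theta>: "ereal \<alpha>' < ereal (\<theta> * x) - \<Lambda> \<theta>" by (rule legendre_transform_gt)
        then have "\<Lambda> \<theta> < \<infinity>" by (cases "\<Lambda> \<theta>") auto
        then show ?thesis using \<theta> \<Lambda>_eq[of \<theta>] unfolding U_def
          by (intro exI[of _ \<theta>]) (metis ereal_minus(1) ereal_less_eq(3) mem_Collect_eq not_le)
      qed
      obtain d where d: "0 < d" "ball 0 d \<subseteq> effective_domain \<Lambda>"
        using zero by (auto simp: mem_interior)
      have "d / 2 \<in> ball 0 d" "- d / 2 \<in> ball 0 d" using d by (auto simp: dist_real_def)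
      then have dfin: "\<Lambda> (d / 2) < \<infinity>" "\<Lambda> (- d / 2) < \<infinity>"
        using d(2) unfolding effective_domain_def by blast+
      define Q where "Q = C - U \<alpha>' (d / 2) - U \<alpha>' (- d / 2)"
      have Uopen: "open (U \<alpha>' \<theta>)" for \<theta>
        unfolding U_def by (intro open_Collect_less continuous_intros)
      have "closed Q" unfolding Q_def using \<open>closed C\<close> Uopen by (intro closed_Diff)
      moreover have "Q \<subseteq> {- 2 * (\<alpha>' + ?f (- d / 2)) / d .. 2 * (\<alpha>' + ?f (d / 2)) / d}"
        using d by (auto simp: Q_def U_def field_simps)
      then have "bounded Q" using bounded_closed_interval bounded_subset by blast
      ultimately have "compact Q" by (simp add: compact_eq_bounded_closed)
      moreover have "Q \<subseteq> (\<Union>\<theta>\<in>{\<theta>. \<Lambda> \<theta> < \<infinity>}. U \<alpha>' \<theta>)" using cov by (auto simp: Q_def)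
      ultimately obtain F where F: "F \<subseteq> {\<theta>. \<Lambda> \<theta> < \<infinity>}" "finite F" "Q \<subseteq> (\<Union>\<theta>\<in>F. U \<alpha>' \<theta>)"
        using Uopen by (elim compactE_image) auto
      define F' where "F' = insert (d / 2) (insert (- d / 2) F)"
      have F': "finite F'" "F' \<noteq> {}" "\<And>\<theta>. \<theta> \<in> F' \<Longrightarrow> \<Lambda> \<theta> < \<infinity>" "C \<subseteq> (\<Union>\<theta>\<in>F'. U \<alpha>' \<theta>)"
        using F dfin by (auto simp: F'_def Q_def)
      have "\<forall>\<^sub>F t in at_top. \<forall>\<theta>\<in>F'. P t (U \<alpha>' \<theta>) \<le> exp (- t * \<alpha>)"
      proof (rule eventually_ball_finite[OF F'(1)], rule ballI)
        fix \<theta> assume "\<theta> \<in> F'"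
        note fin = F'(3)[OF this]
        show "\<forall>\<^sub>F t in at_top. P t (U \<alpha>' \<theta>) \<le> exp (- t * \<alpha>)"
          using Chernoff_halfspace[OF Z int[OF fin] lim[OF fin] \<alpha>'(1)] by (simp add: P_def U_def)
      qed
      then have "\<forall>\<^sub>F t in at_top. P t C \<le> card F' * exp (- t * \<alpha>)"
        using eventually_gt_at_top[of 0]
      proof eventually_elim
        case (elim t)
        note [measurable] = Z[OF \<open>0 < t\<close>]
        have [measurable]: "U \<alpha>' \<theta> \<in> sets borel" for \<theta> using Uopen by (rule borel_open)
        have "P t C \<le> prob (\<Union>\<theta>\<in>F'. {\<omega> \<in> space M. Z t \<omega> / t \<in> U \<alpha>' \<theta>})"
          unfolding P_def using F' by (intro finite_measure_mono) auto
        also have "\<dots> \<le> (\<Sum>\<theta>\<in>F'. P t (U \<alpha>' \<theta>))"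
          unfolding P_def using F'(1) by (intro finite_measure_subadditive_finite) auto
        also have "\<dots> \<le> (\<Sum>\<theta>\<in>F'. exp (- t * \<alpha>))" using elim by (intro sum_mono) auto
        finally show ?case by simp
      qed
      then show ?thesis
        by (rule Limsup_log_prob_le) (use F' in \<open>auto simp: P_def card_gt_0_iff\<close>)
    qed
    show ?thesis
    proof (rule ccontr)
      assume "\<not> ?thesis"
      then have "- Limsup at_top (\<lambda>t. log_prob (P t C) / ereal t) < (INF x\<in>C. ?I x)"
        by (simp add: not_le ereal_uminus_less_reorder)
      then obtain \<alpha> where \<alpha>: "- Limsup at_top (\<lambda>t. log_prob (P t C) / ereal t) < ereal \<alpha>"
        "ereal \<alpha> < (INF x\<in>C. ?I x)"
        using ereal_dense2 by blast
      have "ereal \<alpha> \<le> - Limsup at_top (\<lambda>t. log_prob (P t C) / ereal t)"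
        using ereal_minus_le_minus[THEN iffD2, OF bound[OF \<alpha>(2)]] by simp
      then show False using \<alpha>(1) by simp
    qed
  qed

  have lower: "- (INF x\<in>G. ?I x) \<le> Liminf at_top (\<lambda>t. log_prob (P t G) / ereal t)"
    if "open G" for G
  proof -
    let ?L = "Liminf at_top (\<lambda>t. log_prob (P t G) / ereal t)"
    have "- ?L \<le> ?I x" if "x \<in> G" for x
    proof (cases "?I x = \<infinity>")
      case False
      moreover have "0 \<le> ?I x" using good by (auto simp: good_rate_function_def rate_function_def)
      ultimately obtain B where B: "?I x = ereal B" by (cases "?I x") auto
      obtain \<epsilon> where \<epsilon>: "0 < \<epsilon>" "ball x \<epsilon> \<subseteq> G"
        using \<open>open G\<close> \<open>x \<in> G\<close> by (auto simp: open_contains_ball)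
      obtain \<theta> where \<theta>: "\<theta> \<in> interior (effective_domain \<Lambda>)" "\<bar>deriv ?f \<theta> - x\<bar> < \<epsilon> / 2"
        "\<theta> * deriv ?f \<theta> - ?f \<theta> \<le> B"
        using legendre_transform_exposed_approx[OF smooth cvx zero, of x B "\<epsilon> / 2"] B \<epsilon> by auto
      have "?f differentiable (at \<theta>)" using smooth \<theta>(1) unfolding essentially_smooth_def by blast
      then have der: "(?f has_real_derivative deriv ?f \<theta>) (at \<theta>)"
        by (simp add: DERIV_deriv_iff_real_differentiable)
      have near: "\<forall>\<^sub>F \<theta>' in nhds \<theta>. \<Lambda> \<theta>' < \<infinity>"
        unfolding eventually_nhds using \<theta>(1) interior_subset[of "effective_domain \<Lambda>"]
        by (intro exI[of _ "interior (effective_domain \<Lambda>)"]) (auto simp: effective_domain_def)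
      have "- ereal (B + e) \<le> ?L" if "0 < e" for e
      proof (rule Liminf_log_prob_ge)
        have "\<forall>\<^sub>F t in at_top. exp (- t * (\<theta> * deriv ?f \<theta> - ?f \<theta> + e))
            \<le> prob {\<omega> \<in> space M. \<bar>Z t \<omega> / t - deriv ?f \<theta>\<bar> < \<epsilon> / 2}"
          using near int lim \<epsilon> that by (intro tilted_lower_bound der Z) (auto elim: eventually_mono)
        then show "\<forall>\<^sub>F t in at_top. exp (- t * (B + e)) \<le> P t G"
          using eventually_gt_at_top[of 0]
        proof eventually_elim
          case (elim t)
          note [measurable] = Z[OF \<open>0 < t\<close>] borel_open[OF \<open>open G\<close>]
          have "exp (- t * (B + e)) \<le> exp (- t * (\<theta> * deriv ?f \<theta> - ?f \<theta> + e))"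
            using \<theta>(3) \<open>0 < t\<close> by simp
          also note elim(1)
          also have "prob {\<omega> \<in> space M. \<bar>Z t \<omega> / t - deriv ?f \<theta>\<bar> < \<epsilon> / 2} \<le> P t G"
            unfolding P_def
          proof (intro finite_measure_mono subsetI)
            fix \<omega> assume "\<omega> \<in> {\<omega> \<in> space M. \<bar>Z t \<omega> / t - deriv ?f \<theta>\<bar> < \<epsilon> / 2}"
            then have "\<bar>Z t \<omega> / t - deriv ?f \<theta>\<bar> < \<epsilon> / 2" "\<omega> \<in> space M" by auto
            moreover from this(1) have "\<bar>x - Z t \<omega> / t\<bar> < \<epsilon>" using \<theta>(2) by linarith
            then have "Z t \<omega> / t \<in> ball x \<epsilon>" by (simp add: dist_real_def)
            ultimately show "\<omega> \<in> {\<omega> \<in> space M. Z t \<omega> / t \<in> G}" using \<epsilon> by auto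
          qed measurable
          finally show ?case .
        qed
      qed
      then have "- ?L \<le> ereal B + ereal e" if "0 < e" for e
        using that ereal_uminus_le_reorder by fastforce
      then show ?thesis unfolding B by (rule ereal_le_epsilon2[rule_format])
    qed simp
    then have "- ?L \<le> (INF x\<in>G. ?I x)" by (rule INF_greatest)
    then show ?thesis by (simp add: ereal_uminus_le_reorder)
  qed
  show ?thesis
    unfolding satisfies_LDP_def speed_function_def
    using good upper lower by (auto simp: good_rate_function_def P_def filterlim_ident)
qed

section \<open>Independence of processes and random indices\<close>

definition process_algebra ::
  "'a measure \<Rightarrow> 'i set \<Rightarrow> 'b measure \<Rightarrow> ('i \<Rightarrow> 'a \<Rightarrow> 'b) \<Rightarrow> 'a measure" where
  "process_algebra M I S Y = sigma (space M) (process_sigma M I S Y)"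

lemma process_sigma_Pow: "process_sigma M I S Y \<subseteq> Pow (space M)"
proof -
  have "(\<Union>i\<in>I. {Y i -` A \<inter> space M | A. A \<in> sets S}) \<subseteq> Pow (space M)" by auto
  from sigma_sets_into_sp[OF this] show ?thesis unfolding process_sigma_def by auto
qed

lemma space_process_algebra [simp]: "space (process_algebra M I S Y) = space M"
  unfolding process_algebra_def by (rule space_measure_of) (rule process_sigma_Pow)

lemma sets_process_algebra: "sets (process_algebra M I S Y) = process_sigma M I S Y"
proof -
  have "sets (process_algebra M I S Y) = sigma_sets (space M) (process_sigma M I S Y)"
    unfolding process_algebra_def by (rule sets_measure_of) (rule process_sigma_Pow)
  also have "\<dots> = process_sigma M I S Y"
    unfolding process_sigma_def by (intro sigma_sets_sigma_sets_eq) auto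
  finally show ?thesis .
qed

lemma measurable_process_algebra:
  assumes "i \<in> I" "Y i \<in> measurable M S"
  shows "Y i \<in> measurable (process_algebra M I S Y) S"
proof (rule measurableI)
  show "Y i x \<in> space S" if "x \<in> space (process_algebra M I S Y)" for x
    using assms(2) that by (auto simp: measurable_def)
  show "Y i -` A \<inter> space (process_algebra M I S Y) \<in> sets (process_algebra M I S Y)"
    if "A \<in> sets S" for A
    unfolding sets_process_algebra process_sigma_def space_process_algebra
    using that assms(1) by (intro sigma_sets.Basic) auto
qed

context prob_space
begin

lemma indep_processes_sym:
  assumes "indep_processes M I S Y J T Z"
  shows "indep_processes M J T Z I S Y"
  using assms unfolding indep_processes_def indep_sets2_eq
  by (metis Int_commute mult.commute)

lemma indep_processes_nn_integral_mult:
  fixes f g :: "'a \<Rightarrow> ennreal"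
  assumes indep: "indep_processes M I S Y J T Z"
    and g: "g \<in> borel_measurable (process_algebra M I S Y)"
    and f: "f \<in> borel_measurable (process_algebra M J T Z)"
  shows "(\<integral>\<^sup>+\<omega>. g \<omega> * f \<omega> \<partial>M) = (\<integral>\<^sup>+\<omega>. g \<omega> \<partial>M) * (\<integral>\<^sup>+\<omega>. f \<omega> \<partial>M)"
proof -
  let ?A = "process_sigma M I S Y" and ?B = "process_sigma M J T Z"
  have AB: "?A \<subseteq> events" "?B \<subseteq> events" "\<And>a b. a \<in> ?A \<Longrightarrow> b \<in> ?B \<Longrightarrow> prob (a \<inter> b) = prob a * prob b"
    using indep unfolding indep_processes_def indep_sets2_eq by auto
  have gA: "g -` B \<inter> space M \<in> ?A" if "B \<in> sets borel" for B
    using measurable_sets[OF g that] by (simp add: sets_process_algebra)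
  have fB: "f -` B \<inter> space M \<in> ?B" if "B \<in> sets borel" for B
    using measurable_sets[OF f that] by (simp add: sets_process_algebra)
  have sA: "sigma_sets (space M) {g -` B \<inter> space M | B. B \<in> sets borel} \<subseteq> ?A"
    using sets.sigma_sets_subset[of "{g -` B \<inter> space M | B. B \<in> sets borel}" "process_algebra M I S Y"] gA
    by (auto simp: sets_process_algebra)
  have sB: "sigma_sets (space M) {f -` B \<inter> space M | B. B \<in> sets borel} \<subseteq> ?B"
    using sets.sigma_sets_subset[of "{f -` B \<inter> space M | B. B \<in> sets borel}" "process_algebra M J T Z"] fB
    by (auto simp: sets_process_algebra)
  have meas: "g \<in> borel_measurable M" "f \<in> borel_measurable M"
    using gA fB AB(1,2) by (auto intro!: measurableI)
  have "indep_var borel g borel f"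
    unfolding indep_var_eq indep_sets2_eq
    by (intro conjI ballI meas order_trans[OF sA AB(1)] order_trans[OF sB AB(2)]
        AB(3) subsetD[OF sA] subsetD[OF sB])
  then have "indep_vars (\<lambda>_. borel) (case_bool g f) UNIV"
    unfolding indep_var_def by (rule back_subst[where P = "\<lambda>F. indep_vars F _ _"])
      (auto split: bool.split)
  from indep_vars_nn_integral[OF _ this] show ?thesis by (simp add: UNIV_bool mult.commute)
qed

lemma nn_integral_random_index:
  fixes f :: "nat \<Rightarrow> 'a \<Rightarrow> ennreal" and K :: "'a \<Rightarrow> nat"
  assumes indep: "indep_processes M I S Y J T Z"
    and K: "K \<in> measurable (process_algebra M I S Y) (count_space UNIV)"
    and f: "\<And>n. f n \<in> borel_measurable (process_algebra M J T Z)"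
  shows "(\<integral>\<^sup>+\<omega>. f (K \<omega>) \<omega> \<partial>M) = (\<integral>\<^sup>+\<omega>. (\<integral>\<^sup>+\<omega>'. f (K \<omega>) \<omega>' \<partial>M) \<partial>M)"
proof -
  have sub: "process_sigma M I S Y \<subseteq> events" "process_sigma M J T Z \<subseteq> events"
    using indep unfolding indep_processes_def indep_sets2_eq by auto
  have ind: "indicator (K -` {n} \<inter> space M) \<in> borel_measurable (process_algebra M I S Y)" for n
    using measurable_sets[OF K, of "{n}"] by (intro borel_measurable_indicator) simp
  have fM[measurable]: "f n \<in> borel_measurable M" for n
    using measurable_mono[of borel borel "process_algebra M J T Z" M] sub f by (auto simp: sets_process_algebra)
  have iM[measurable]: "indicator (K -` {n} \<inter> space M) \<in> borel_measurable M" for n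
    using measurable_mono[of borel borel "process_algebra M I S Y" M] sub ind by (auto simp: sets_process_algebra)
  have expand: "h (K \<omega>) = (\<Sum>n. indicator (K -` {n} \<inter> space M) \<omega> * h n)"
    if "\<omega> \<in> space M" for h :: "nat \<Rightarrow> ennreal" and \<omega>
  proof -
    have "(\<Sum>n. indicator (K -` {n} \<inter> space M) \<omega> * h n)
        = (\<Sum>n\<in>{K \<omega>}. indicator (K -` {n} \<inter> space M) \<omega> * h n)"
      using that by (intro suminf_finite) auto
    then show ?thesis using that by simp
  qed
  have "(\<integral>\<^sup>+\<omega>. f (K \<omega>) \<omega> \<partial>M) = (\<integral>\<^sup>+\<omega>. (\<Sum>n. indicator (K -` {n} \<inter> space M) \<omega> * f n \<omega>) \<partial>M)"
    by (intro nn_integral_cong expand)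
  also have "\<dots> = (\<Sum>n. \<integral>\<^sup>+\<omega>. indicator (K -` {n} \<inter> space M) \<omega> * f n \<omega> \<partial>M)"
    by (intro nn_integral_suminf) measurable
  also have "\<dots> = (\<Sum>n. (\<integral>\<^sup>+\<omega>. indicator (K -` {n} \<inter> space M) \<omega> \<partial>M) * (\<integral>\<^sup>+\<omega>. f n \<omega> \<partial>M))"
    by (intro suminf_cong indep_processes_nn_integral_mult[OF indep] ind f)
  also have "\<dots> = (\<Sum>n. \<integral>\<^sup>+\<omega>. indicator (K -` {n} \<inter> space M) \<omega> * (\<integral>\<^sup>+\<omega>'. f n \<omega>' \<partial>M) \<partial>M)"
    by (intro suminf_cong nn_integral_multc[symmetric]) measurable
  also have "\<dots> = (\<integral>\<^sup>+\<omega>. (\<Sum>n. indicator (K -` {n} \<inter> space M) \<omega> * (\<integral>\<^sup>+\<omega>'. f n \<omega>' \<partial>M)) \<partial>M)"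
    by (intro nn_integral_suminf[symmetric]) measurable
  also have "\<dots> = (\<integral>\<^sup>+\<omega>. (\<integral>\<^sup>+\<omega>'. f (K \<omega>) \<omega>' \<partial>M) \<partial>M)"
    by (intro nn_integral_cong expand[symmetric])
  finally show ?thesis .
qed

end

lemma nn_integral_poisson_power:
  assumes "0 < r" "0 \<le> m"
  shows "(\<integral>\<^sup>+k. ennreal (m ^ k) \<partial>measure_pmf (poisson_pmf r)) = ennreal (exp (r * (m - 1)))"
proof -
  have "(\<lambda>k. (r * m) ^ k /\<^sub>R fact k) sums exp (r * m)" by (rule exp_converges)
  from sums_mult[OF this, of "exp (- r)"]
  have "(\<lambda>k. r ^ k / fact k * exp (- r) * m ^ k) sums exp (r * (m - 1))"
    by (simp add: power_mult_distrib field_simps exp_add[symmetric] exp_diff exp_minus)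
  then have "(\<Sum>k. ennreal (r ^ k / fact k * exp (- r) * m ^ k)) = ennreal (exp (r * (m - 1)))"
    using assms by (intro suminf_ennreal_eq) auto
  moreover have "ennreal (pmf (poisson_pmf r) k) * ennreal (m ^ k)
      = ennreal (r ^ k / fact k * exp (- r) * m ^ k)" for k
    unfolding pmf_poisson[OF \<open>0 < r\<close>] by (rule ennreal_mult[symmetric]) (use assms in auto)
  ultimately show ?thesis
    unfolding nn_integral_measure_pmf nn_integral_count_space_nat by simp
qed

lemma (in prob_space) poisson_process_power:
  assumes P: "poisson_process M lam P" and "0 < lam" "0 \<le> s" "0 \<le> m"
  shows "(\<integral>\<^sup>+\<omega>. ennreal (m ^ P s \<omega>) \<partial>M) = ennreal (exp (lam * (m - 1) * s))"
proof (cases "s = 0")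
  case True
  have "AE \<omega> in M. P 0 \<omega> = 0" using P by (auto simp: poisson_process_def subordinator_def)
  then have "(\<integral>\<^sup>+\<omega>. ennreal (m ^ P s \<omega>) \<partial>M) = (\<integral>\<^sup>+\<omega>. 1 \<partial>M)"
    using True by (intro nn_integral_cong_AE) auto
  then show ?thesis using True by (simp add: emeasure_space_1)
next
  case False
  then have "0 < s" using \<open>0 \<le> s\<close> by simp
  have [measurable]: "P s \<in> measurable M (count_space UNIV)"
    using P \<open>0 \<le> s\<close> by (auto simp: poisson_process_def)
  have "(\<integral>\<^sup>+\<omega>. ennreal (m ^ P s \<omega>) \<partial>M) = (\<integral>\<^sup>+k. ennreal (m ^ k) \<partial>distr M (count_space UNIV) (P s))"
    by (subst nn_integral_distr) auto
  also have "\<dots> = ennreal (exp (lam * s * (m - 1)))"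
    using P \<open>0 < s\<close> nn_integral_poisson_power[of "lam * s" m] assms by (simp add: poisson_process_def)
  finally show ?thesis by (simp add: ac_simps)
qed

section \<open>Cumulants of the inverse stable subordinator\<close>

context prob_space
begin

lemma stable_subordinator_integrable:
  assumes "stable_subordinator M \<nu> D" "0 \<le> s" "0 \<le> \<xi>"
  shows "integrable M (\<lambda>\<omega>. exp (- \<xi> * D s \<omega>))"
proof (rule ccontr)
  assume "\<not> ?thesis"
  then have "expectation (\<lambda>\<omega>. exp (- \<xi> * D s \<omega>)) = 0" by (rule not_integrable_integral_eq)
  then show False using assms by (auto simp: stable_subordinator_def)
qed

lemma stable_subordinator_lower_tail:
  assumes D: "stable_subordinator M \<nu> D" and "0 \<le> s" "0 \<le> \<xi>"
  shows "prob {\<omega> \<in> space M. D s \<omega> \<le> t} \<le> exp (\<xi> * t - s * \<xi> powr \<nu>)"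
proof -
  have [measurable]: "D s \<in> borel_measurable M"
    using assms by (auto simp: stable_subordinator_def subordinator_def)
  let ?A = "{\<omega> \<in> space M. D s \<omega> \<le> t}"
  have "prob ?A = expectation (indicator ?A)" by simp
  also have "\<dots> \<le> expectation (\<lambda>\<omega>. exp (\<xi> * t) * exp (- \<xi> * D s \<omega>))"
  proof (rule integral_mono)
    show "integrable M (indicator ?A :: 'a \<Rightarrow> real)"
      by (intro integrable_real_indicator) (auto simp: emeasure_eq_measure)
    show "integrable M (\<lambda>\<omega>. exp (\<xi> * t) * exp (- \<xi> * D s \<omega>))"
      using stable_subordinator_integrable[OF assms] by simp
    show "indicator ?A \<omega> \<le> exp (\<xi> * t) * exp (- \<xi> * D s \<omega>)" for \<omega>
    proof (cases "\<omega> \<in> ?A")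
      case True
      then have "\<xi> * D s \<omega> \<le> \<xi> * t" using \<open>0 \<le> \<xi>\<close> by (intro mult_left_mono) auto
      then show ?thesis using True by (simp add: exp_add[symmetric])
    qed simp
  qed
  also have "\<dots> = exp (\<xi> * t) * exp (- s * \<xi> powr \<nu>)"
    using assms by (simp add: stable_subordinator_def)
  also have "\<dots> = exp (\<xi> * t - s * \<xi> powr \<nu>)" by (simp add: exp_add[symmetric])
  finally show ?thesis .
qed

lemma stable_subordinator_unbounded:
  assumes D: "stable_subordinator M \<nu> D"
  shows "AE \<omega> in M. \<exists>s\<ge>0. t < D s \<omega>"
proof -
  have [measurable]: "D (real n) \<in> borel_measurable M" for n
    using assms by (auto simp: stable_subordinator_def subordinator_def)
  let ?A = "{\<omega> \<in> space M. \<forall>n::nat. D (real n) \<omega> \<le> t}"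
  have "prob ?A \<le> exp (t - real n)" for n :: nat
  proof -
    have "prob ?A \<le> prob {\<omega> \<in> space M. D (real n) \<omega> \<le> t}"
      by (intro finite_measure_mono) auto
    also have "\<dots> \<le> exp (t - real n)"
      using stable_subordinator_lower_tail[OF D, of "real n" 1 t] by simp
    finally show ?thesis .
  qed
  moreover have "(\<lambda>n. exp (t - real n)) \<longlonglongrightarrow> 0" by real_asymp
  ultimately have "prob ?A \<le> 0" by (intro LIMSEQ_le_const) auto
  then have "prob ?A = 0" using measure_nonneg[of M ?A] by linarith
  then have "AE \<omega> in M. \<not> (\<forall>n::nat. D (real n) \<omega> \<le> t)"
    by (subst AE_iff_measurable[of ?A]) (auto simp: emeasure_eq_measure)
  then show ?thesis by eventually_elim (metis not_le of_nat_0_le_iff)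
qed

lemma inverse_stable_subordinatorE:
  assumes L: "inverse_stable_subordinator M \<nu> L"
  obtains D where "stable_subordinator M \<nu> D"
    and "\<And>t. 0 \<le> t \<Longrightarrow> AE \<omega> in M. 0 \<le> L t \<omega> \<and>
      (\<forall>s\<ge>0. (s < L t \<omega> \<longrightarrow> D s \<omega> \<le> t) \<and> (D s \<omega> \<le> t \<longrightarrow> s \<le> L t \<omega>))"
proof -
  obtain D where D: "stable_subordinator M \<nu> D"
    and LD: "AE \<omega> in M. \<forall>t\<ge>0. L t \<omega> = Inf {s. 0 \<le> s \<and> t < D s \<omega>}"
    using L by (auto simp: inverse_stable_subordinator_def)
  have mono: "AE \<omega> in M. mono_on {0..} (\<lambda>t. D t \<omega>)"
    using D by (auto simp: stable_subordinator_def subordinator_def elim: eventually_mono)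
  have "AE \<omega> in M. 0 \<le> L t \<omega> \<and>
      (\<forall>s\<ge>0. (s < L t \<omega> \<longrightarrow> D s \<omega> \<le> t) \<and> (D s \<omega> \<le> t \<longrightarrow> s \<le> L t \<omega>))" if "0 \<le> t" for t
    using LD mono stable_subordinator_unbounded[OF D, of t]
  proof eventually_elim
    case (elim \<omega>)
    let ?A = "{s. 0 \<le> s \<and> t < D s \<omega>}"
    have "?A \<noteq> {}" using elim(3) by auto
    have "bdd_below ?A" by (rule bdd_belowI[of _ 0]) auto
    have eq: "L t \<omega> = Inf ?A" using elim(1) that by simp
    have "0 \<le> Inf ?A" using \<open>?A \<noteq> {}\<close> by (intro cInf_greatest) auto
    moreover have "D s \<omega> \<le> t" if "0 \<le> s" "s < Inf ?A" for s
    proof (rule ccontr)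
      assume "\<not> D s \<omega> \<le> t"
      then have "Inf ?A \<le> s" using that \<open>bdd_below ?A\<close> by (intro cInf_lower) auto
      then show False using that by simp
    qed
    moreover have "s \<le> Inf ?A" if "0 \<le> s" "D s \<omega> \<le> t" for s
    proof (rule cInf_greatest[OF \<open>?A \<noteq> {}\<close>])
      fix r assume "r \<in> ?A"
      show "s \<le> r"
      proof (rule ccontr)
        assume "\<not> s \<le> r"
        then have "D r \<omega> \<le> D s \<omega>" using \<open>r \<in> ?A\<close> that by (intro mono_onD[OF elim(2)]) auto
        then show False using \<open>r \<in> ?A\<close> that by simp
      qed
    qed
    ultimately show ?case unfolding eq by blast
  qed
  with D show ?thesis using that by blast
qed

lemma inverse_stable_exp_moment_le:
  assumes L: "inverse_stable_subordinator M \<nu> L" and "0 \<le> t" "0 \<le> c" "0 < \<xi>" "c < \<xi> powr \<nu>"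
  shows "(\<integral>\<^sup>+\<omega>. ennreal (exp (c * L t \<omega>)) \<partial>M)
    \<le> ennreal (1 + exp (\<xi> * t) * (exp c / (1 - exp (c - \<xi> powr \<nu>))))"
proof -
  obtain D where D: "stable_subordinator M \<nu> D"
    and "\<And>t. 0 \<le> t \<Longrightarrow> AE \<omega> in M. 0 \<le> L t \<omega> \<and>
      (\<forall>s\<ge>0. (s < L t \<omega> \<longrightarrow> D s \<omega> \<le> t) \<and> (D s \<omega> \<le> t \<longrightarrow> s \<le> L t \<omega>))"
    using inverse_stable_subordinatorE[OF L] by blast
  note LD = this(2)[OF \<open>0 \<le> t\<close>]
  have [measurable]: "D (real j) \<in> borel_measurable M" for j
    using D by (auto simp: stable_subordinator_def subordinator_def)
  define A where "A j = {\<omega> \<in> space M. D (real j) \<omega> \<le> t}" for j :: nat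
  have [measurable]: "A j \<in> events" for j unfolding A_def by measurable
  define q where "q = exp (c - \<xi> powr \<nu>)"
  have q: "0 \<le> q" "q < 1" using assms by (auto simp: q_def)
  have "(\<integral>\<^sup>+\<omega>. ennreal (exp (c * L t \<omega>)) \<partial>M)
      \<le> (\<integral>\<^sup>+\<omega>. 1 + (\<Sum>j. ennreal (exp (c * (real j + 1))) * indicator (A j) \<omega>) \<partial>M)"
  proof (rule nn_integral_mono_AE)
    show "AE \<omega> in M. ennreal (exp (c * L t \<omega>))
        \<le> 1 + (\<Sum>j. ennreal (exp (c * (real j + 1))) * indicator (A j) \<omega>)"
      using LD AE_space
    proof eventually_elim
      case (elim \<omega>)
      show ?case
      proof (cases "L t \<omega> = 0")
        case False
        define j where "j = nat (\<lceil>L t \<omega>\<rceil> - 1)"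
        have j: "real j < L t \<omega>" "L t \<omega> \<le> real j + 1" using elim False unfolding j_def by linarith+
        then have "\<omega> \<in> A j" using elim by (auto simp: A_def)
        define g where "g i = ennreal (exp (c * (real i + 1))) * indicator (A i) \<omega>" for i
        have "ennreal (exp (c * L t \<omega>)) \<le> g j"
          using j \<open>\<omega> \<in> A j\<close> \<open>0 \<le> c\<close> by (auto intro!: ennreal_leI mult_left_mono simp: g_def)
        also have "g j \<le> (\<Sum>i. g i)" using sum_le_suminf[of g "{j}"] by simp
        also have "(\<Sum>i. g i) = (\<Sum>i. ennreal (exp (c * (real i + 1))) * indicator (A i) \<omega>)"
          by (simp add: g_def)
        finally show ?thesis by (rule order_trans) simp
      qed simp
    qed
  qed
  also have "\<dots> = 1 + (\<Sum>j. ennreal (exp (c * (real j + 1))) * emeasure M (A j))"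
    by (simp add: nn_integral_add nn_integral_suminf nn_integral_cmult_indicator emeasure_space_1)
  also have "\<dots> \<le> 1 + (\<Sum>j. ennreal (exp (\<xi> * t) * exp c * q ^ j))"
  proof (intro add_left_mono suminf_le)
    fix j :: nat
    have "exp (c * (real j + 1)) * prob (A j) \<le> exp (c * (real j + 1)) * exp (\<xi> * t - real j * \<xi> powr \<nu>)"
      using stable_subordinator_lower_tail[OF D, of "real j" \<xi> t] \<open>0 < \<xi>\<close>
      by (intro mult_left_mono) (auto simp: A_def)
    also have "\<dots> = exp (\<xi> * t) * exp c * q ^ j"
      by (simp add: q_def exp_of_nat_mult[symmetric] exp_add[symmetric] algebra_simps)
    finally show "ennreal (exp (c * (real j + 1))) * emeasure M (A j) \<le> ennreal (exp (\<xi> * t) * exp c * q ^ j)"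
      by (simp add: emeasure_eq_measure ennreal_mult[symmetric] ennreal_leI)
  qed auto
  also have "(\<Sum>j. ennreal (exp (\<xi> * t) * exp c * q ^ j)) = ennreal (exp (\<xi> * t) * exp c * (1 / (1 - q)))"
    using q by (intro suminf_ennreal_eq sums_mult geometric_sums) auto
  finally show ?thesis using q
    by (simp add: q_def ennreal_plus[symmetric] ennreal_1[symmetric] del: ennreal_plus ennreal_1)
qed

lemma inverse_stable_exp_integrable:
  assumes L: "inverse_stable_subordinator M \<nu> L" and "0 < \<nu>" "0 \<le> t"
  shows "integrable M (\<lambda>\<omega>. exp (c * L t \<omega>))"
proof -
  have [measurable]: "L t \<in> borel_measurable M"
    using L \<open>0 \<le> t\<close> by (auto simp: inverse_stable_subordinator_def)
  define \<xi> where "\<xi> = (\<bar>c\<bar> + 1) powr (1 / \<nu>)"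
  have "\<xi> powr \<nu> = \<bar>c\<bar> + 1" using \<open>0 < \<nu>\<close> by (simp add: \<xi>_def powr_powr)
  then have "(\<integral>\<^sup>+\<omega>. ennreal (exp (\<bar>c\<bar> * L t \<omega>)) \<partial>M)
      \<le> ennreal (1 + exp (\<xi> * t) * (exp \<bar>c\<bar> / (1 - exp (\<bar>c\<bar> - \<xi> powr \<nu>))))"
    by (intro inverse_stable_exp_moment_le[OF L \<open>0 \<le> t\<close>]) (auto simp: \<xi>_def)
  also have "\<dots> < \<infinity>" by simp
  finally have "(\<integral>\<^sup>+\<omega>. ennreal (exp (\<bar>c\<bar> * L t \<omega>)) \<partial>M) < \<infinity>" .
  then have int: "integrable M (\<lambda>\<omega>. exp (\<bar>c\<bar> * L t \<omega>))"
    by (intro integrableI_nonneg) auto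
  obtain D where "\<And>t. 0 \<le> t \<Longrightarrow> AE \<omega> in M. 0 \<le> L t \<omega> \<and>
      (\<forall>s\<ge>0. (s < L t \<omega> \<longrightarrow> D s \<omega> \<le> t) \<and> (D s \<omega> \<le> t \<longrightarrow> s \<le> L t \<omega>))"
    using inverse_stable_subordinatorE[OF L] by blast
  from this[OF \<open>0 \<le> t\<close>] have "AE \<omega> in M. norm (exp (c * L t \<omega>)) \<le> norm (exp (\<bar>c\<bar> * L t \<omega>))"
    by eventually_elim (auto intro!: mult_right_mono)
  then show ?thesis by (intro Bochner_Integration.integrable_bound[OF int]) auto
qed

lemma inverse_stable_cumulant_limit_pos:
  assumes L: "inverse_stable_subordinator M \<nu> L" and \<nu>: "0 < \<nu>" "\<nu> < 1" and "0 < c"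
  shows "((\<lambda>t. ln (expectation (\<lambda>\<omega>. exp (c * L t \<omega>))) / t) \<longlongrightarrow> c powr (1 / \<nu>)) at_top"
proof (rule order_tendstoI)
  define \<xi> where "\<xi> = c powr (1 / \<nu>)"
  have \<xi>: "0 < \<xi>" "\<xi> powr \<nu> = c" using \<nu> \<open>0 < c\<close> by (auto simp: \<xi>_def powr_powr)
  fix a assume "c powr (1 / \<nu>) < a"
  then have "\<xi> < a" by (simp add: \<xi>_def)
  define \<xi>' where "\<xi>' = (\<xi> + a) / 2"
  have \<xi>': "\<xi> < \<xi>'" "\<xi>' < a" "0 < \<xi>'" using \<open>\<xi> < a\<close> \<xi> by (auto simp: \<xi>'_def)
  have lt: "c < \<xi>' powr \<nu>" using powr_less_mono2[OF \<nu>(1) _ \<xi>'(1)] \<xi> by simp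
  define C where "C = exp c / (1 - exp (c - \<xi>' powr \<nu>))"
  have "0 < C" using lt by (simp add: C_def)
  have "((\<lambda>t. ln (1 + exp (\<xi>' * t) * C) / t) \<longlongrightarrow> \<xi>') at_top"
    using \<open>0 < C\<close> \<xi>' by real_asymp
  then have "\<forall>\<^sub>F t in at_top. ln (1 + exp (\<xi>' * t) * C) / t < a"
    using \<xi>' by (intro order_tendstoD(2)) auto
  then show "\<forall>\<^sub>F t in at_top. ln (expectation (\<lambda>\<omega>. exp (c * L t \<omega>))) / t < a"
    using eventually_gt_at_top[of 0]
  proof eventually_elim
    case (elim t)
    have int: "integrable M (\<lambda>\<omega>. exp (c * L t \<omega>))"
      using inverse_stable_exp_integrable[OF L \<nu>(1)] elim by simp
    have "ennreal (expectation (\<lambda>\<omega>. exp (c * L t \<omega>))) \<le> ennreal (1 + exp (\<xi>' * t) * C)"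
      using inverse_stable_exp_moment_le[OF L, of t c \<xi>'] elim \<open>0 < c\<close> \<xi>' lt
      unfolding C_def by (subst nn_integral_eq_integral[OF int, symmetric]) auto
    then have "expectation (\<lambda>\<omega>. exp (c * L t \<omega>)) \<le> 1 + exp (\<xi>' * t) * C"
      using \<open>0 < C\<close> by (subst (asm) ennreal_le_iff) auto
    then have "ln (expectation (\<lambda>\<omega>. exp (c * L t \<omega>))) \<le> ln (1 + exp (\<xi>' * t) * C)"
      using expectation_exp_pos[OF int] by simp
    then have "ln (expectation (\<lambda>\<omega>. exp (c * L t \<omega>))) / t \<le> ln (1 + exp (\<xi>' * t) * C) / t"
      using \<open>0 < t\<close> by (simp add: divide_right_mono)
    then show ?case using elim by simp
  qed
next
  define \<xi> where "\<xi> = c powr (1 / \<nu>)"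
  have \<xi>: "0 < \<xi>" "\<xi> powr \<nu> = c" using \<nu> \<open>0 < c\<close> by (auto simp: \<xi>_def powr_powr)
  fix a assume "a < c powr (1 / \<nu>)"
  then have "a < \<xi>" by (simp add: \<xi>_def)
  define \<epsilon> where "\<epsilon> = min (1 / 2) ((\<xi> - a) / (4 * \<xi>))"
  have \<epsilon>: "0 < \<epsilon>" "\<epsilon> < 1" using \<open>a < \<xi>\<close> \<xi> by (auto simp: \<epsilon>_def)
  have "\<epsilon> * \<xi> \<le> (\<xi> - a) / (4 * \<xi>) * \<xi>" using \<xi> by (intro mult_right_mono) (auto simp: \<epsilon>_def)
  then have \<epsilon>\<xi>: "\<epsilon> * \<xi> \<le> (\<xi> - a) / 4" using \<xi> by simp
  define \<kappa> where "\<kappa> = (1 - \<epsilon>) * \<xi> powr (1 - \<nu>) / \<nu>"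
  have "0 < \<kappa>" using \<epsilon> \<nu> \<xi> by (simp add: \<kappa>_def)
  obtain D where D: "stable_subordinator M \<nu> D"
    and LD: "\<And>t. 0 \<le> t \<Longrightarrow> AE \<omega> in M. 0 \<le> L t \<omega> \<and>
      (\<forall>s\<ge>0. (s < L t \<omega> \<longrightarrow> D s \<omega> \<le> t) \<and> (D s \<omega> \<le> t \<longrightarrow> s \<le> L t \<omega>))"
    using inverse_stable_subordinatorE[OF L] by blast
  have Dm: "D s \<in> borel_measurable M" if "0 \<le> s" for s
    using D that by (auto simp: stable_subordinator_def subordinator_def)
  \<comment> \<open>\<open>\<kappa>\<close> is chosen so that tilting by \<open>- \<xi>\<close> moves \<open>D (\<kappa> * t) / t\<close> to \<open>1 - \<epsilon>\<close>, just below \<open>1\<close>.\<close>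
  define \<Lambda> where "\<Lambda> \<theta> = - \<kappa> * (- \<theta>) powr \<nu>" for \<theta>
  have der: "(\<Lambda> has_real_derivative 1 - \<epsilon>) (at (- \<xi>))"
  proof -
    have "(\<Lambda> has_real_derivative \<kappa> * (\<nu> * \<xi> powr (\<nu> - 1))) (at (- \<xi>))"
      unfolding \<Lambda>_def using \<xi> by (auto intro!: derivative_eq_intros)
    also have "\<kappa> * (\<nu> * \<xi> powr (\<nu> - 1)) = (1 - \<epsilon>) * (\<xi> powr (1 - \<nu>) * \<xi> powr (\<nu> - 1))"
      using \<nu> by (simp add: \<kappa>_def)
    also have "\<dots> = 1 - \<epsilon>" using \<xi> by (simp add: powr_add[symmetric])
    finally show ?thesis .
  qed
  have near: "\<forall>\<^sub>F \<theta> in nhds (- \<xi>). \<theta> < 0"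
    using eventually_nhds_in_open[of "{..<0}" "- \<xi>"] \<xi> by simp
  have "\<forall>\<^sub>F t in at_top. exp (- t * (- \<xi> * (1 - \<epsilon>) - \<Lambda> (- \<xi>) + (\<xi> - a) / 4))
      \<le> prob {\<omega> \<in> space M. \<bar>D (\<kappa> * t) \<omega> / t - (1 - \<epsilon>)\<bar> < \<epsilon>}"
  proof (rule tilted_lower_bound[OF _ _ der])
    show "D (\<kappa> * t) \<in> borel_measurable M" if "0 < t" for t using that \<open>0 < \<kappa>\<close> by (intro Dm) simp
    show "\<forall>\<^sub>F \<theta> in nhds (- \<xi>). (\<forall>\<^sub>F t in at_top. integrable M (\<lambda>\<omega>. exp (\<theta> * D (\<kappa> * t) \<omega>))) \<and>
        ((\<lambda>t. ln (expectation (\<lambda>\<omega>. exp (\<theta> * D (\<kappa> * t) \<omega>))) / t) \<longlongrightarrow> \<Lambda> \<theta>) at_top"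
      using near
    proof eventually_elim
      case (elim \<theta>)
      have *: "integrable M (\<lambda>\<omega>. exp (\<theta> * D (\<kappa> * t) \<omega>))"
        "ln (expectation (\<lambda>\<omega>. exp (\<theta> * D (\<kappa> * t) \<omega>))) / t = \<Lambda> \<theta>" if "0 < t" for t
      proof -
        show "integrable M (\<lambda>\<omega>. exp (\<theta> * D (\<kappa> * t) \<omega>))"
          using stable_subordinator_integrable[OF D, of "\<kappa> * t" "- \<theta>"] elim that \<open>0 < \<kappa>\<close> by simp
        have "expectation (\<lambda>\<omega>. exp (- (- \<theta>) * D (\<kappa> * t) \<omega>)) = exp (- (\<kappa> * t) * (- \<theta>) powr \<nu>)"
          using D elim that \<open>0 < \<kappa>\<close> unfolding stable_subordinator_def
          by (metis less_imp_le mult_pos_pos neg_0_le_iff_le)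
        then show "ln (expectation (\<lambda>\<omega>. exp (\<theta> * D (\<kappa> * t) \<omega>))) / t = \<Lambda> \<theta>"
          using that by (simp add: \<Lambda>_def)
      qed
      then show ?case
        by (intro conjI tendsto_eventually eventually_mono[OF eventually_gt_at_top[of 0]]) auto
    qed
  qed (use \<epsilon> \<open>a < \<xi>\<close> in auto)
  then show "\<forall>\<^sub>F t in at_top. a < ln (expectation (\<lambda>\<omega>. exp (c * L t \<omega>))) / t"
    using eventually_gt_at_top[of 0]
  proof eventually_elim
    case (elim t)
    have [measurable]: "D (\<kappa> * t) \<in> borel_measurable M" "L t \<in> borel_measurable M"
      using Dm \<open>0 < \<kappa>\<close> \<open>0 < t\<close> L by (auto simp: inverse_stable_subordinator_def)
    have int: "integrable M (\<lambda>\<omega>. exp (c * L t \<omega>))"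
      using inverse_stable_exp_integrable[OF L \<nu>(1)] elim by simp
    let ?A = "{\<omega> \<in> space M. \<bar>D (\<kappa> * t) \<omega> / t - (1 - \<epsilon>)\<bar> < \<epsilon>}"
    have "exp (c * (\<kappa> * t)) * exp (- t * (- \<xi> * (1 - \<epsilon>) - \<Lambda> (- \<xi>) + (\<xi> - a) / 4))
        \<le> exp (c * (\<kappa> * t)) * prob ?A" using elim by simp
    also have "\<dots> = expectation (\<lambda>\<omega>. exp (c * (\<kappa> * t)) * indicator ?A \<omega>)" by simp
    also have "\<dots> \<le> expectation (\<lambda>\<omega>. exp (c * L t \<omega>))"
    proof (rule integral_mono_AE)
      show "integrable M (\<lambda>\<omega>. exp (c * (\<kappa> * t)) * indicator ?A \<omega> :: real)"
        by (intro integrable_mult_right integrable_real_indicator) (auto simp: emeasure_eq_measure)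
      show "AE \<omega> in M. exp (c * (\<kappa> * t)) * indicator ?A \<omega> \<le> exp (c * L t \<omega>)"
        using LD[of t, OF less_imp_le[OF \<open>0 < t\<close>]]
      proof eventually_elim
        case (elim \<omega>)
        show ?case
        proof (cases "\<omega> \<in> ?A")
          case True
          then have "D (\<kappa> * t) \<omega> / t < 1" by auto
          then have "D (\<kappa> * t) \<omega> \<le> t" using \<open>0 < t\<close> by (simp add: field_simps)
          then have "\<kappa> * t \<le> L t \<omega>" using elim \<open>0 < \<kappa>\<close> \<open>0 < t\<close> by simp
          then show ?thesis using True \<open>0 < c\<close> by simp
        qed simp
      qed
    qed (rule int)
    finally have "exp (c * (\<kappa> * t) - t * (- \<xi> * (1 - \<epsilon>) - \<Lambda> (- \<xi>) + (\<xi> - a) / 4))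
        \<le> expectation (\<lambda>\<omega>. exp (c * L t \<omega>))"
      by (simp add: exp_add[symmetric])
    moreover have "c * (\<kappa> * t) - t * (- \<xi> * (1 - \<epsilon>) - \<Lambda> (- \<xi>) + (\<xi> - a) / 4)
        = t * (\<xi> - \<epsilon> * \<xi> - (\<xi> - a) / 4)"
      using \<xi> by (simp add: \<Lambda>_def algebra_simps)
    ultimately have "t * (\<xi> - \<epsilon> * \<xi> - (\<xi> - a) / 4) \<le> ln (expectation (\<lambda>\<omega>. exp (c * L t \<omega>)))"
      using expectation_exp_pos[OF int] by (simp add: ln_ge_iff)
    then have "\<xi> - \<epsilon> * \<xi> - (\<xi> - a) / 4 \<le> ln (expectation (\<lambda>\<omega>. exp (c * L t \<omega>))) / t"
      using \<open>0 < t\<close> by (simp add: field_simps)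
    then show ?case using \<epsilon>\<xi> \<open>a < \<xi>\<close> by (simp add: field_simps)
  qed
qed

lemma inverse_stable_cumulant_limit_nonpos:
  assumes L: "inverse_stable_subordinator M \<nu> L" and \<nu>: "0 < \<nu>" "\<nu> < 1" and "c \<le> 0"
  shows "((\<lambda>t. ln (expectation (\<lambda>\<omega>. exp (c * L t \<omega>))) / t) \<longlongrightarrow> 0) at_top"
proof (rule order_tendstoI)
  obtain D where D: "stable_subordinator M \<nu> D"
    and LD: "\<And>t. 0 \<le> t \<Longrightarrow> AE \<omega> in M. 0 \<le> L t \<omega> \<and>
      (\<forall>s\<ge>0. (s < L t \<omega> \<longrightarrow> D s \<omega> \<le> t) \<and> (D s \<omega> \<le> t \<longrightarrow> s \<le> L t \<omega>))"
    using inverse_stable_subordinatorE[OF L] by blast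
  {
    fix a :: real assume "0 < a"
    show "\<forall>\<^sub>F t in at_top. ln (expectation (\<lambda>\<omega>. exp (c * L t \<omega>))) / t < a"
      using eventually_gt_at_top[of 0]
    proof eventually_elim
      case (elim t)
      have int: "integrable M (\<lambda>\<omega>. exp (c * L t \<omega>))"
        using inverse_stable_exp_integrable[OF L \<nu>(1)] elim by simp
      have "expectation (\<lambda>\<omega>. exp (c * L t \<omega>)) \<le> expectation (\<lambda>\<omega>. 1)"
        using LD[OF less_imp_le[OF elim]] \<open>c \<le> 0\<close>
        by (intro integral_mono_AE int) (auto elim!: eventually_mono simp: mult_nonpos_nonneg)
      then have "ln (expectation (\<lambda>\<omega>. exp (c * L t \<omega>))) \<le> 0"
        using expectation_exp_pos[OF int] by (simp add: prob_space)
      then have "ln (expectation (\<lambda>\<omega>. exp (c * L t \<omega>))) / t \<le> 0"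
        using elim by (simp add: divide_nonpos_pos)
      then show ?case using \<open>0 < a\<close> by simp
    qed
  next
    fix a :: real assume "a < 0"
    define \<epsilon> where "\<epsilon> = - a / 2 / (1 - c)"
    have "0 < \<epsilon>" using \<open>a < 0\<close> \<open>c \<le> 0\<close> unfolding \<epsilon>_def by (intro divide_pos_pos) auto
    have "- c * \<epsilon> \<le> (1 - c) * \<epsilon>" using \<open>0 < \<epsilon>\<close> by (simp add: algebra_simps)
    also have "\<dots> = - a / 2" using \<open>c \<le> 0\<close> unfolding \<epsilon>_def by (intro nonzero_mult_div_cancel_left[of "1 - c", folded times_divide_eq_right]) simp
    finally have c\<epsilon>: "a / 2 \<le> c * \<epsilon>" by simp
    define \<xi> where "\<xi> = (\<epsilon> / 2) powr (1 / (1 - \<nu>))"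
    have "0 < \<xi>" using \<open>0 < \<epsilon>\<close> by (simp add: \<xi>_def)
    have "\<xi> powr (1 - \<nu>) = \<epsilon> / 2" using \<open>0 < \<epsilon>\<close> \<nu> by (simp add: \<xi>_def powr_powr)
    then have "\<epsilon> * \<xi> powr \<nu> = 2 * (\<xi> powr (1 - \<nu>) * \<xi> powr \<nu>)" by simp
    also have "\<dots> = 2 * \<xi>" using \<open>0 < \<xi>\<close> by (simp add: powr_add[symmetric])
    finally have \<xi>: "\<epsilon> * \<xi> powr \<nu> = 2 * \<xi>" .
    have "\<forall>\<^sub>F t in at_top. exp (- \<xi> * t) < 1 / 2 \<and> ln 2 < t * (- a / 2)"
      using \<open>0 < \<xi>\<close> \<open>a < 0\<close> by (intro eventually_conj; real_asymp)
    then show "\<forall>\<^sub>F t in at_top. a < ln (expectation (\<lambda>\<omega>. exp (c * L t \<omega>))) / t"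
      using eventually_gt_at_top[of 0]
    proof eventually_elim
      case (elim t)
      have [measurable]: "D (\<epsilon> * t) \<in> borel_measurable M"
        using D \<open>0 < \<epsilon>\<close> \<open>0 < t\<close> by (auto simp: stable_subordinator_def subordinator_def)
      have int: "integrable M (\<lambda>\<omega>. exp (c * L t \<omega>))"
        using inverse_stable_exp_integrable[OF L \<nu>(1)] elim by simp
      let ?A = "{\<omega> \<in> space M. D (\<epsilon> * t) \<omega> \<le> t}"
      have "prob ?A \<le> exp (\<xi> * t - (\<epsilon> * t) * \<xi> powr \<nu>)"
        using \<open>0 < \<epsilon>\<close> \<open>0 < t\<close> \<open>0 < \<xi>\<close> by (intro stable_subordinator_lower_tail D) auto
      also have "\<xi> * t - (\<epsilon> * t) * \<xi> powr \<nu> = - \<xi> * t"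
        using \<xi> by (simp add: algebra_simps)
      finally have "prob ?A \<le> 1 / 2" using elim by simp
      then have "1 / 2 \<le> prob (space M - ?A)" by (simp add: prob_compl)
      then have "exp (c * (\<epsilon> * t)) * (1 / 2) \<le> exp (c * (\<epsilon> * t)) * prob (space M - ?A)" by simp
      also have "\<dots> = expectation (\<lambda>\<omega>. exp (c * (\<epsilon> * t)) * indicator (space M - ?A) \<omega>)" by simp
      also have "\<dots> \<le> expectation (\<lambda>\<omega>. exp (c * L t \<omega>))"
      proof (rule integral_mono_AE)
        show "integrable M (\<lambda>\<omega>. exp (c * (\<epsilon> * t)) * indicator (space M - ?A) \<omega> :: real)"
          by (intro integrable_mult_right integrable_real_indicator) (auto simp: emeasure_eq_measure)
        show "AE \<omega> in M. exp (c * (\<epsilon> * t)) * indicator (space M - ?A) \<omega> \<le> exp (c * L t \<omega>)"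
          using LD[OF less_imp_le[OF \<open>0 < t\<close>]]
        proof eventually_elim
          case (elim \<omega>)
          show ?case
          proof (cases "\<omega> \<in> space M - ?A")
            case True
            then have "\<not> D (\<epsilon> * t) \<omega> \<le> t" by auto
            then have "L t \<omega> \<le> \<epsilon> * t" using elim \<open>0 < \<epsilon>\<close> \<open>0 < t\<close> by (meson less_imp_le mult_pos_pos not_le)
            then show ?thesis using True \<open>c \<le> 0\<close> by (simp add: mult_left_mono_neg)
          qed simp
        qed
      qed (rule int)
      finally have "ln (exp (c * (\<epsilon> * t)) * (1 / 2)) \<le> ln (expectation (\<lambda>\<omega>. exp (c * L t \<omega>)))"
        using expectation_exp_pos[OF int] by simp
      then have "t * (c * \<epsilon>) - ln 2 \<le> ln (expectation (\<lambda>\<omega>. exp (c * L t \<omega>)))"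
        by (simp add: ln_mult ln_div algebra_simps)
      moreover have "t * (a / 2) \<le> t * (c * \<epsilon>)" using c\<epsilon> \<open>0 < t\<close> by (intro mult_left_mono) auto
      moreover have "t * (a / 2) = t * a / 2" "t * (- a / 2) = - (t * a / 2)" by simp_all
      ultimately have "t * a < ln (expectation (\<lambda>\<omega>. exp (c * L t \<omega>)))" using elim by linarith
      then show ?case using \<open>0 < t\<close> by (simp add: field_simps)
    qed
  }
qed

lemma inverse_stable_cumulant_limit:
  assumes "inverse_stable_subordinator M \<nu> L" "0 < \<nu>" "\<nu> < 1"
  shows "((\<lambda>t. ln (expectation (\<lambda>\<omega>. exp (c * L t \<omega>))) / t) \<longlongrightarrow> max c 0 powr (1 / \<nu>)) at_top"
  using inverse_stable_cumulant_limit_pos[OF assms] inverse_stable_cumulant_limit_nonpos[OF assms]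
  by (cases "0 < c") (simp_all add: max_def)

end

section \<open>The compound fractional Poisson process\<close>

lemma (in prob_space) time_fractional_poisson_process_power_bounds:
  assumes N: "time_fractional_poisson_process M \<nu> lam N" and "0 < lam"
  obtains L where "inverse_stable_subordinator M \<nu> L"
    and "\<And>t m c. 0 \<le> t \<Longrightarrow> 0 \<le> m \<Longrightarrow> c = lam * (m - 1) \<Longrightarrow>
      ennreal (exp (- \<bar>c\<bar>)) * (\<integral>\<^sup>+\<omega>. ennreal (exp (c * L t \<omega>)) \<partial>M) \<le> (\<integral>\<^sup>+\<omega>. ennreal (m ^ N t \<omega>) \<partial>M) \<and>
      (\<integral>\<^sup>+\<omega>. ennreal (m ^ N t \<omega>) \<partial>M) \<le> ennreal (exp \<bar>c\<bar>) * (\<integral>\<^sup>+\<omega>. ennreal (exp (c * L t \<omega>)) \<partial>M)"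
proof -
  obtain P L where P: "poisson_process M lam P" and L: "inverse_stable_subordinator M \<nu> L"
    and PL: "indep_processes M {0..} (count_space UNIV) P {0..} borel L"
    and NPL: "AE \<omega> in M. \<forall>t\<ge>0. N t \<omega> = P (L t \<omega>) \<omega>"
    using N unfolding time_fractional_poisson_process_def by blast
  have mono: "AE \<omega> in M. mono_on {0..} (\<lambda>t. real (P t \<omega>))"
    using P by (auto simp: poisson_process_def subordinator_def elim: eventually_mono)
  have Lm: "L t \<in> borel_measurable M" if "0 \<le> t" for t
    using L that by (auto simp: inverse_stable_subordinator_def)
  obtain D where L_nonneg: "\<And>t. 0 \<le> t \<Longrightarrow> AE \<omega> in M. 0 \<le> L t \<omega> \<and>
      (\<forall>s\<ge>0. (s < L t \<omega> \<longrightarrow> D s \<omega> \<le> t) \<and> (D s \<omega> \<le> t \<longrightarrow> s \<le> L t \<omega>))"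
    using inverse_stable_subordinatorE[OF L] by blast
  have "ennreal (exp (- \<bar>c\<bar>)) * (\<integral>\<^sup>+\<omega>. ennreal (exp (c * L t \<omega>)) \<partial>M) \<le> (\<integral>\<^sup>+\<omega>. ennreal (m ^ N t \<omega>) \<partial>M) \<and>
      (\<integral>\<^sup>+\<omega>. ennreal (m ^ N t \<omega>) \<partial>M) \<le> ennreal (exp \<bar>c\<bar>) * (\<integral>\<^sup>+\<omega>. ennreal (exp (c * L t \<omega>)) \<partial>M)"
    if "0 \<le> t" "0 \<le> m" and c: "c = lam * (m - 1)" for t m c
  proof -
    note [measurable] = Lm[OF \<open>0 \<le> t\<close>]
    define K where "K i \<omega> = nat \<lfloor>L t \<omega>\<rfloor> + i" for i \<omega>
    have "L t \<in> borel_measurable (process_algebra M {0..} borel L)"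
      using \<open>0 \<le> t\<close> by (intro measurable_process_algebra Lm) auto
    then have Km: "K i \<in> measurable (process_algebra M {0..} borel L) (count_space UNIV)" for i
      unfolding K_def by measurable
    have Pm: "(\<lambda>\<omega>. ennreal (m ^ P (real n) \<omega>)) \<in> borel_measurable (process_algebra M {0..} (count_space UNIV) P)" for n
    proof -
      have "P (real n) \<in> measurable (process_algebra M {0..} (count_space UNIV) P) (count_space UNIV)"
        using P by (intro measurable_process_algebra) (auto simp: poisson_process_def)
      then show ?thesis by measurable
    qed
    have EK: "(\<integral>\<^sup>+\<omega>. ennreal (m ^ P (real (K i \<omega>)) \<omega>) \<partial>M) = (\<integral>\<^sup>+\<omega>. ennreal (exp (c * real (K i \<omega>))) \<partial>M)" for i
      using nn_integral_random_index[OF indep_processes_sym[OF PL] Km[of i] Pm]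
        poisson_process_power[OF P \<open>0 < lam\<close> _ \<open>0 \<le> m\<close>] by (simp add: c)
    have ae: "AE \<omega> in M. P (real (K 0 \<omega>)) \<omega> \<le> N t \<omega> \<and> N t \<omega> \<le> P (real (K 1 \<omega>)) \<omega> \<and>
        real (K 0 \<omega>) \<le> L t \<omega> \<and> L t \<omega> \<le> real (K 0 \<omega>) + 1"
      using NPL mono L_nonneg[OF \<open>0 \<le> t\<close>]
    proof eventually_elim
      case (elim \<omega>)
      have K: "real (K 0 \<omega>) \<le> L t \<omega>" "L t \<omega> \<le> real (K 1 \<omega>)" "real (K 1 \<omega>) = real (K 0 \<omega>) + 1"
        using elim(3) unfolding K_def by linarith+
      have "real (P (real (K 0 \<omega>)) \<omega>) \<le> real (P (L t \<omega>) \<omega>)"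
        using K elim(3) by (intro mono_onD[OF elim(2)]) auto
      moreover have "real (P (L t \<omega>) \<omega>) \<le> real (P (real (K 1 \<omega>)) \<omega>)"
        using K elim(3) by (intro mono_onD[OF elim(2)]) auto
      ultimately show ?case using K elim(1) \<open>0 \<le> t\<close> by auto
    qed
    have sandwich: "ennreal (exp (- \<bar>c\<bar>)) * (\<integral>\<^sup>+\<omega>. ennreal (exp (c * L t \<omega>)) \<partial>M)
          \<le> (\<integral>\<^sup>+\<omega>. ennreal (exp (c * real (K i \<omega>))) \<partial>M)"
        "(\<integral>\<^sup>+\<omega>. ennreal (exp (c * real (K i \<omega>))) \<partial>M)
          \<le> ennreal (exp \<bar>c\<bar>) * (\<integral>\<^sup>+\<omega>. ennreal (exp (c * L t \<omega>)) \<partial>M)"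
      if "i \<in> {0, 1}" for i
    proof -
      have near: "AE \<omega> in M. c * L t \<omega> - \<bar>c\<bar> \<le> c * real (K i \<omega>) \<and> c * real (K i \<omega>) \<le> c * L t \<omega> + \<bar>c\<bar>"
        using ae
      proof eventually_elim
        case (elim \<omega>)
        have "real (K 1 \<omega>) = real (K 0 \<omega>) + 1" by (simp add: K_def)
        then have "\<bar>real (K i \<omega>) - L t \<omega>\<bar> \<le> 1" using elim that by auto
        then have "\<bar>c * (real (K i \<omega>) - L t \<omega>)\<bar> \<le> \<bar>c\<bar>"
          unfolding abs_mult by (intro mult_left_le) auto
        then show ?case unfolding right_diff_distrib by linarith
      qed
      have "ennreal (exp (- \<bar>c\<bar>)) * (\<integral>\<^sup>+\<omega>. ennreal (exp (c * L t \<omega>)) \<partial>M)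
          = (\<integral>\<^sup>+\<omega>. ennreal (exp (c * L t \<omega> - \<bar>c\<bar>)) \<partial>M)"
        by (simp add: nn_integral_cmult[symmetric] ennreal_mult[symmetric] exp_add[symmetric])
      also have "\<dots> \<le> (\<integral>\<^sup>+\<omega>. ennreal (exp (c * real (K i \<omega>))) \<partial>M)"
        using near by (intro nn_integral_mono_AE) (auto elim!: eventually_mono intro!: ennreal_leI)
      finally show "ennreal (exp (- \<bar>c\<bar>)) * (\<integral>\<^sup>+\<omega>. ennreal (exp (c * L t \<omega>)) \<partial>M)
          \<le> (\<integral>\<^sup>+\<omega>. ennreal (exp (c * real (K i \<omega>))) \<partial>M)" .
      have "(\<integral>\<^sup>+\<omega>. ennreal (exp (c * real (K i \<omega>))) \<partial>M) \<le> (\<integral>\<^sup>+\<omega>. ennreal (exp (c * L t \<omega> + \<bar>c\<bar>)) \<partial>M)"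
        using near by (intro nn_integral_mono_AE) (auto elim!: eventually_mono intro!: ennreal_leI)
      also have "\<dots> = ennreal (exp \<bar>c\<bar>) * (\<integral>\<^sup>+\<omega>. ennreal (exp (c * L t \<omega>)) \<partial>M)"
        by (simp add: nn_integral_cmult[symmetric] ennreal_mult[symmetric] exp_add[symmetric] add.commute)
      finally show "(\<integral>\<^sup>+\<omega>. ennreal (exp (c * real (K i \<omega>))) \<partial>M)
          \<le> ennreal (exp \<bar>c\<bar>) * (\<integral>\<^sup>+\<omega>. ennreal (exp (c * L t \<omega>)) \<partial>M)" .
    qed
    obtain i j where ij: "i \<in> {0, 1}" "j \<in> {0, 1}"
      "AE \<omega> in M. m ^ P (real (K i \<omega>)) \<omega> \<le> m ^ N t \<omega> \<and> m ^ N t \<omega> \<le> m ^ P (real (K j \<omega>)) \<omega>"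
    proof (cases "1 \<le> m")
      case True
      have "AE \<omega> in M. m ^ P (real (K 0 \<omega>)) \<omega> \<le> m ^ N t \<omega> \<and> m ^ N t \<omega> \<le> m ^ P (real (K 1 \<omega>)) \<omega>"
        using ae by eventually_elim (auto intro: power_increasing[OF _ True])
      then show ?thesis by (intro that[of 0 1]) auto
    next
      case False
      then have "m \<le> 1" by simp
      have "AE \<omega> in M. m ^ P (real (K 1 \<omega>)) \<omega> \<le> m ^ N t \<omega> \<and> m ^ N t \<omega> \<le> m ^ P (real (K 0 \<omega>)) \<omega>"
        using ae by eventually_elim (auto intro: power_decreasing[OF _ \<open>0 \<le> m\<close> \<open>m \<le> 1\<close>])
      then show ?thesis by (intro that[of 1 0]) auto
    qed
    have "(\<integral>\<^sup>+\<omega>. ennreal (m ^ P (real (K i \<omega>)) \<omega>) \<partial>M) \<le> (\<integral>\<^sup>+\<omega>. ennreal (m ^ N t \<omega>) \<partial>M)"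
      "(\<integral>\<^sup>+\<omega>. ennreal (m ^ N t \<omega>) \<partial>M) \<le> (\<integral>\<^sup>+\<omega>. ennreal (m ^ P (real (K j \<omega>)) \<omega>) \<partial>M)"
    proof -
      show "(\<integral>\<^sup>+\<omega>. ennreal (m ^ P (real (K i \<omega>)) \<omega>) \<partial>M) \<le> (\<integral>\<^sup>+\<omega>. ennreal (m ^ N t \<omega>) \<partial>M)"
        by (rule nn_integral_mono_AE) (use ij(3) in \<open>eventually_elim, auto intro: ennreal_leI\<close>)
      show "(\<integral>\<^sup>+\<omega>. ennreal (m ^ N t \<omega>) \<partial>M) \<le> (\<integral>\<^sup>+\<omega>. ennreal (m ^ P (real (K j \<omega>)) \<omega>) \<partial>M)"
        by (rule nn_integral_mono_AE) (use ij(3) in \<open>eventually_elim, auto intro: ennreal_leI\<close>)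
    qed
    with sandwich(1)[OF ij(1)] sandwich(2)[OF ij(2)] show ?thesis
      unfolding EK by (blast intro: order_trans)
  qed
  with L show ?thesis using that by blast
qed

lemma (in prob_space) nn_integral_exp_random_sum:
  assumes X_indep: "indep_vars (\<lambda>_. borel) X {1..}"
    and X_ident: "\<And>n. 1 \<le> n \<Longrightarrow> distr M borel (X n) = distr M borel (X 1)"
    and indep: "indep_processes M I (count_space UNIV) N {1..} borel X"
    and "t \<in> I" and N: "N t \<in> measurable M (count_space UNIV)"
    and fin: "moment_gen M (X 1) \<theta> < \<infinity>"
  shows "(\<integral>\<^sup>+\<omega>. ennreal (exp (\<theta> * (\<Sum>k = 1..N t \<omega>. X k \<omega>))) \<partial>M)
    = (\<integral>\<^sup>+\<omega>. ennreal (enn2real (moment_gen M (X 1) \<theta>) ^ N t \<omega>) \<partial>M)"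
proof -
  define m where "m = enn2real (moment_gen M (X 1) \<theta>)"
  have m: "ennreal m = moment_gen M (X 1) \<theta>" using fin by (simp add: m_def)
  have Xm[measurable]: "X k \<in> borel_measurable M" if "1 \<le> k" for k
    using X_indep that by (auto simp: indep_vars_def)
  have "(\<lambda>\<omega>. ennreal (exp (\<theta> * (\<Sum>k = 1..n. X k \<omega>)))) \<in> borel_measurable (process_algebra M {1..} borel X)" for n
  proof -
    have "X k \<in> borel_measurable (process_algebra M {1..} borel X)" if "k \<in> {1..n}" for k
      using that by (intro measurable_process_algebra Xm) auto
    then have "(\<lambda>\<omega>. \<Sum>k = 1..n. X k \<omega>) \<in> borel_measurable (process_algebra M {1..} borel X)"
      by (rule borel_measurable_sum)
    then show ?thesis by measurable
  qed
  moreover have "N t \<in> measurable (process_algebra M I (count_space UNIV) N) (count_space UNIV)"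
    using \<open>t \<in> I\<close> N by (rule measurable_process_algebra)
  ultimately have index: "(\<integral>\<^sup>+\<omega>. ennreal (exp (\<theta> * (\<Sum>k = 1..N t \<omega>. X k \<omega>))) \<partial>M)
    = (\<integral>\<^sup>+\<omega>. (\<integral>\<^sup>+\<omega>'. ennreal (exp (\<theta> * (\<Sum>k = 1..N t \<omega>. X k \<omega>'))) \<partial>M) \<partial>M)"
    by (intro nn_integral_random_index[OF indep])
  have inner: "(\<integral>\<^sup>+\<omega>'. ennreal (exp (\<theta> * (\<Sum>k = 1..n. X k \<omega>'))) \<partial>M) = ennreal (m ^ n)" for n
  proof -
    have "indep_vars (\<lambda>_. borel) X {1..n}" by (rule indep_vars_subset[OF X_indep]) auto
    then have ind: "indep_vars (\<lambda>_. borel) (\<lambda>k \<omega>. ennreal (exp (\<theta> * X k \<omega>))) {1..n}"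
      by (rule indep_vars_compose2) measurable
    have one: "(\<integral>\<^sup>+\<omega>. ennreal (exp (\<theta> * X k \<omega>)) \<partial>M) = ennreal m" if "k \<in> {1..n}" for k
    proof -
      have "(\<integral>\<^sup>+\<omega>. ennreal (exp (\<theta> * X k \<omega>)) \<partial>M) = (\<integral>\<^sup>+x. ennreal (exp (\<theta> * x)) \<partial>distr M borel (X k))"
        using that by (subst nn_integral_distr) auto
      also have "\<dots> = (\<integral>\<^sup>+x. ennreal (exp (\<theta> * x)) \<partial>distr M borel (X 1))"
        using X_ident[of k] that by simp
      also have "\<dots> = ennreal m" unfolding m moment_gen_def by (subst nn_integral_distr) auto
      finally show ?thesis .
    qed
    have "(\<integral>\<^sup>+\<omega>'. ennreal (exp (\<theta> * (\<Sum>k = 1..n. X k \<omega>'))) \<partial>M)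
        = (\<integral>\<^sup>+\<omega>'. (\<Prod>k = 1..n. ennreal (exp (\<theta> * X k \<omega>'))) \<partial>M)"
      by (simp add: sum_distrib_left exp_sum prod_ennreal)
    also have "\<dots> = (\<Prod>k = 1..n. ennreal m)"
      using indep_vars_nn_integral[OF _ ind] one by simp
    finally show ?thesis by (simp add: ennreal_power m_def)
  qed
  show ?thesis unfolding index inner by (simp add: m_def)
qed

lemma Lambda_frac_finite_iff: "Lambda_frac M \<nu> lam Y \<theta> < \<infinity> \<longleftrightarrow> moment_gen M Y \<theta> < \<infinity>"
  by (auto simp: Lambda_frac_def less_top)

lemma effective_domain_Lambda_frac:
  "effective_domain (Lambda_frac M \<nu> lam Y) = {\<theta>. moment_gen M Y \<theta> < \<infinity>}"
  unfolding effective_domain_def Lambda_frac_finite_iff ..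

lemma real_Lambda_frac:
  assumes "moment_gen M Y \<theta> < \<infinity>" "0 < lam"
  shows "real_of_ereal (Lambda_frac M \<nu> lam Y \<theta>)
    = max (lam * (enn2real (moment_gen M Y \<theta>) - 1)) 0 powr (1 / \<nu>)"
proof -
  have m: "moment_gen M Y \<theta> = ennreal (enn2real (moment_gen M Y \<theta>))" using assms(1) by simp
  have "1 < moment_gen M Y \<theta> \<longleftrightarrow> 1 < enn2real (moment_gen M Y \<theta>)"
    by (subst m) (simp add: ennreal_less_iff[of 1, simplified])
  then show ?thesis
    using assms by (auto simp: Lambda_frac_def max_def mult_le_0_iff not_less)
qed

lemma powr_pos_part_convex:
  fixes p :: real
  assumes "1 \<le> p"
  shows "convex_on UNIV (\<lambda>x. max x 0 powr p)"
proof (rule convex_onI)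
  fix t x y :: real assume t: "0 < t" "t < 1"
  have scale: "(s * z) powr p \<le> s * z powr p" if "0 < s" "s < 1" "0 \<le> z" for s z :: real
  proof -
    have "s powr p \<le> s powr 1" using that assms by (intro powr_mono') auto
    then have "s powr p * z powr p \<le> s * z powr p" using that by (intro mult_right_mono) auto
    then show ?thesis using that by (simp add: powr_mult)
  qed
  have "((1 - t) * a + t * b) powr p \<le> (1 - t) * a powr p + t * b powr p"
    if "0 \<le> a" "0 \<le> b" for a b :: real
  proof (cases "a = 0 \<or> b = 0")
    case True
    then show ?thesis using scale[of t b] scale[of "1 - t" a] t that by auto
  next
    case False
    then show ?thesis using convex_onD[OF powr_convex[OF assms], of t a b] t that by simp
  qed
  from this[of "max x 0" "max y 0"]
  have "((1 - t) * max x 0 + t * max y 0) powr p \<le> (1 - t) * max x 0 powr p + t * max y 0 powr p"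
    by simp
  moreover have "max ((1 - t) * x + t * y) 0 \<le> (1 - t) * max x 0 + t * max y 0"
  proof -
    have "(1 - t) * x \<le> (1 - t) * max x 0" "t * y \<le> t * max y 0"
      using t by (auto intro!: mult_left_mono)
    moreover have "0 \<le> (1 - t) * max x 0" "0 \<le> t * max y 0" using t by auto
    ultimately show ?thesis by linarith
  qed
  then have "max ((1 - t) * x + t * y) 0 powr p \<le> ((1 - t) * max x 0 + t * max y 0) powr p"
    using assms by (intro powr_mono2) auto
  ultimately show "max ((1 - t) *\<^sub>R x + t *\<^sub>R y) 0 powr p \<le> (1 - t) * max x 0 powr p + t * max y 0 powr p"
    by simp
qed simp

lemma moment_gen_convex:
  assumes [measurable]: "Y \<in> borel_measurable M" and "0 \<le> u" "0 \<le> v" "u + v = 1"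
  shows "moment_gen M Y (u * a + v * b) \<le> ennreal u * moment_gen M Y a + ennreal v * moment_gen M Y b"
proof -
  have "moment_gen M Y (u * a + v * b)
      \<le> (\<integral>\<^sup>+\<omega>. ennreal u * ennreal (exp (a * Y \<omega>)) + ennreal v * ennreal (exp (b * Y \<omega>)) \<partial>M)"
    unfolding moment_gen_def
  proof (rule nn_integral_mono)
    fix \<omega>
    have "exp (u * (a * Y \<omega>) + v * (b * Y \<omega>)) \<le> u * exp (a * Y \<omega>) + v * exp (b * Y \<omega>)"
      using exp_convex assms unfolding convex_on_def by simp
    moreover have "(u * a + v * b) * Y \<omega> = u * (a * Y \<omega>) + v * (b * Y \<omega>)"
      by (simp add: algebra_simps)
    ultimately have "ennreal (exp ((u * a + v * b) * Y \<omega>)) \<le> ennreal (u * exp (a * Y \<omega>) + v * exp (b * Y \<omega>))"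
      by (intro ennreal_leI) simp
    then show "ennreal (exp ((u * a + v * b) * Y \<omega>))
        \<le> ennreal u * ennreal (exp (a * Y \<omega>)) + ennreal v * ennreal (exp (b * Y \<omega>))"
      using assms by (simp add: ennreal_plus ennreal_mult)
  qed
  also have "\<dots> = ennreal u * moment_gen M Y a + ennreal v * moment_gen M Y b"
    unfolding moment_gen_def by (simp add: nn_integral_add nn_integral_cmult)
  finally show ?thesis .
qed

lemma convex_on_Lambda_frac:
  assumes "Y \<in> borel_measurable M" "0 < lam" "0 < \<nu>" "\<nu> < 1"
  shows "convex_on (effective_domain (Lambda_frac M \<nu> lam Y)) (\<lambda>\<theta>. real_of_ereal (Lambda_frac M \<nu> lam Y \<theta>))"
  unfolding convex_on_def convex_def
proof (intro conjI ballI allI impI)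
  let ?D = "effective_domain (Lambda_frac M \<nu> lam Y)"
  define m where "m \<theta> = enn2real (moment_gen M Y \<theta>)" for \<theta>
  fix a b u v :: real
  assume D: "a \<in> ?D" "b \<in> ?D" and uv: "0 \<le> u" "0 \<le> v" "u + v = 1"
  have fin: "moment_gen M Y a < \<infinity>" "moment_gen M Y b < \<infinity>"
    using D by (simp_all only: effective_domain_Lambda_frac mem_Collect_eq)
  have "moment_gen M Y (u * a + v * b) \<le> ennreal u * ennreal (m a) + ennreal v * ennreal (m b)"
    using moment_gen_convex[OF assms(1) uv] fin by (simp add: m_def)
  also have "\<dots> = ennreal (u * m a + v * m b)"
    using uv by (simp add: ennreal_plus ennreal_mult m_def)
  finally have le: "moment_gen M Y (u * a + v * b) \<le> ennreal (u * m a + v * m b)" .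
  then have fin': "moment_gen M Y (u * a + v * b) < \<infinity>" by (rule le_less_trans) simp
  then show "u *\<^sub>R a + v *\<^sub>R b \<in> ?D" by (simp only: effective_domain_Lambda_frac mem_Collect_eq real_scaleR_def)
  have "m (u * a + v * b) \<le> u * m a + v * m b"
    unfolding m_def[of "u * a + v * b"] using le uv by (intro enn2real_leI) (auto simp: m_def)
  then have "lam * m (u * a + v * b) \<le> lam * (u * m a + v * m b)"
    using \<open>0 < lam\<close> by (intro mult_left_mono) auto
  moreover have "u * (lam * (m a - 1)) + v * (lam * (m b - 1)) = lam * (u * m a + v * m b) - lam * (u + v)"
    by (simp add: algebra_simps)
  ultimately have "lam * (m (u * a + v * b) - 1) \<le> u * (lam * (m a - 1)) + v * (lam * (m b - 1))"
    unfolding uv(3) by (simp add: algebra_simps)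
  then have "max (lam * (m (u * a + v * b) - 1)) 0 powr (1 / \<nu>)
      \<le> max (u * (lam * (m a - 1)) + v * (lam * (m b - 1))) 0 powr (1 / \<nu>)"
    using \<open>0 < \<nu>\<close> by (intro powr_mono2) auto
  also have "\<dots> \<le> u * max (lam * (m a - 1)) 0 powr (1 / \<nu>) + v * max (lam * (m b - 1)) 0 powr (1 / \<nu>)"
    using powr_pos_part_convex[of "1 / \<nu>"] assms uv unfolding convex_on_def by simp
  finally show "real_of_ereal (Lambda_frac M \<nu> lam Y (u *\<^sub>R a + v *\<^sub>R b))
      \<le> u * real_of_ereal (Lambda_frac M \<nu> lam Y a) + v * real_of_ereal (Lambda_frac M \<nu> lam Y b)"
    using fin fin' \<open>0 < lam\<close> by (simp add: real_Lambda_frac m_def)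
qed

theorem proposition3p1:
  fixes M :: "'a measure"
    and \<nu> lam :: real
    and X :: "nat \<Rightarrow> 'a \<Rightarrow> real"
    and N :: "real \<Rightarrow> 'a \<Rightarrow> nat"
    and S :: "real \<Rightarrow> 'a \<Rightarrow> real"
  assumes "prob_space M"
    and "0 < \<nu>" and "\<nu> < 1" and "0 < lam"
    and X_indep: "prob_space.indep_vars M (\<lambda>_. borel) X {1..}"
    and X_ident: "\<And>n. 1 \<le> n \<Longrightarrow> distr M borel (X n) = distr M borel (X 1)"
    and X_mgf: "\<forall>\<^sub>F \<theta> in nhds 0. moment_gen M (X 1) \<theta> < \<infinity>"
    and N_tfpp: "time_fractional_poisson_process M \<nu> lam N"
    and N_X_indep: "indep_processes M {0..} (count_space UNIV) N {1..} borel X"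
    and S_def: "\<And>t \<omega>. 0 \<le> t \<Longrightarrow> \<omega> \<in> space M \<Longrightarrow> S t \<omega> = (\<Sum>k = 1..N t \<omega>. X k \<omega>)"
    and smooth: "essentially_smooth (Lambda_frac M \<nu> lam (X 1))"
  shows "satisfies_LDP M (\<lambda>t \<omega>. S t \<omega> / t) (\<lambda>t. t)
           (legendre_transform (Lambda_frac M \<nu> lam (X 1)))
       \<and> good_rate_function (legendre_transform (Lambda_frac M \<nu> lam (X 1)))"
proof -
  interpret prob_space M by fact
  let ?\<Lambda> = "Lambda_frac M \<nu> lam (X 1)"
  have Xm: "X k \<in> borel_measurable M" if "1 \<le> k" for k
    using X_indep that by (auto simp: indep_vars_def)
  have Nm: "N t \<in> measurable M (count_space UNIV)" if "0 \<le> t" for t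
    using N_tfpp that by (auto simp: time_fractional_poisson_process_def)
  have Sm: "S t \<in> borel_measurable M" if "0 \<le> t" for t
  proof -
    have "(\<lambda>\<omega>. \<Sum>k = 1..N t \<omega>. X k \<omega>) \<in> borel_measurable M"
      by (rule measurable_compose_countable[OF _ Nm[OF that]])
        (auto intro!: borel_measurable_sum Xm)
    then show ?thesis by (subst measurable_cong[OF S_def[OF that]]) auto
  qed
  obtain L where L: "inverse_stable_subordinator M \<nu> L"
    and bounds: "\<And>t m c. 0 \<le> t \<Longrightarrow> 0 \<le> m \<Longrightarrow> c = lam * (m - 1) \<Longrightarrow>
      ennreal (exp (- \<bar>c\<bar>)) * (\<integral>\<^sup>+\<omega>. ennreal (exp (c * L t \<omega>)) \<partial>M) \<le> (\<integral>\<^sup>+\<omega>. ennreal (m ^ N t \<omega>) \<partial>M) \<and>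
      (\<integral>\<^sup>+\<omega>. ennreal (m ^ N t \<omega>) \<partial>M) \<le> ennreal (exp \<bar>c\<bar>) * (\<integral>\<^sup>+\<omega>. ennreal (exp (c * L t \<omega>)) \<partial>M)"
    using time_fractional_poisson_process_power_bounds[OF N_tfpp \<open>0 < lam\<close>] by blast
  have key: "integrable M (\<lambda>\<omega>. exp (\<theta> * S t \<omega>)) \<and>
      exp (- \<bar>c\<bar>) * expectation (\<lambda>\<omega>. exp (c * L t \<omega>)) \<le> expectation (\<lambda>\<omega>. exp (\<theta> * S t \<omega>)) \<and>
      expectation (\<lambda>\<omega>. exp (\<theta> * S t \<omega>)) \<le> exp \<bar>c\<bar> * expectation (\<lambda>\<omega>. exp (c * L t \<omega>))"
    if fin: "moment_gen M (X 1) \<theta> < \<infinity>" and c: "c = lam * (enn2real (moment_gen M (X 1) \<theta>) - 1)"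
      and "0 \<le> t" for \<theta> t c
  proof -
    note [measurable] = Sm[OF \<open>0 \<le> t\<close>]
    have intL: "integrable M (\<lambda>\<omega>. exp (c * L t \<omega>))"
      using inverse_stable_exp_integrable[OF L \<open>0 < \<nu>\<close> \<open>0 \<le> t\<close>] .
    then have EL: "(\<integral>\<^sup>+\<omega>. ennreal (exp (c * L t \<omega>)) \<partial>M) = ennreal (expectation (\<lambda>\<omega>. exp (c * L t \<omega>)))"
      by (intro nn_integral_eq_integral) auto
    have EL0: "0 < expectation (\<lambda>\<omega>. exp (c * L t \<omega>))" by (rule expectation_exp_pos[OF intL])
    have "(\<integral>\<^sup>+\<omega>. ennreal (exp (\<theta> * S t \<omega>)) \<partial>M)
        = (\<integral>\<^sup>+\<omega>. ennreal (exp (\<theta> * (\<Sum>k = 1..N t \<omega>. X k \<omega>))) \<partial>M)"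
      using S_def[OF \<open>0 \<le> t\<close>] by (intro nn_integral_cong) auto
    also have "\<dots> = (\<integral>\<^sup>+\<omega>. ennreal (enn2real (moment_gen M (X 1) \<theta>) ^ N t \<omega>) \<partial>M)"
      using \<open>0 \<le> t\<close> by (intro nn_integral_exp_random_sum[OF X_indep X_ident N_X_indep _ Nm fin]) auto
    finally have b: "ennreal (exp (- \<bar>c\<bar>) * expectation (\<lambda>\<omega>. exp (c * L t \<omega>)))
          \<le> (\<integral>\<^sup>+\<omega>. ennreal (exp (\<theta> * S t \<omega>)) \<partial>M)"
        "(\<integral>\<^sup>+\<omega>. ennreal (exp (\<theta> * S t \<omega>)) \<partial>M)
          \<le> ennreal (exp \<bar>c\<bar> * expectation (\<lambda>\<omega>. exp (c * L t \<omega>)))"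
      using bounds[OF \<open>0 \<le> t\<close> enn2real_nonneg c] EL EL0 by (simp_all add: ennreal_mult)
    have intS: "integrable M (\<lambda>\<omega>. exp (\<theta> * S t \<omega>))"
      by (rule integrableI_nonneg) (auto intro: le_less_trans[OF b(2)])
    then have "(\<integral>\<^sup>+\<omega>. ennreal (exp (\<theta> * S t \<omega>)) \<partial>M) = ennreal (expectation (\<lambda>\<omega>. exp (\<theta> * S t \<omega>)))"
      by (intro nn_integral_eq_integral) auto
    with b intS EL0 expectation_exp_pos[OF intS] show ?thesis by (simp add: ennreal_le_iff)
  qed
  show ?thesis
  proof (rule Gartner_Ellis_real[OF _ _ _ _ _ smooth])
    show "S t \<in> borel_measurable M" if "0 < t" for t using that by (intro Sm) simp
    show "convex_on (effective_domain ?\<Lambda>) (\<lambda>\<theta>. real_of_ereal (?\<Lambda> \<theta>))"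
      using Xm[of 1] assms(2-4) by (intro convex_on_Lambda_frac) auto
    obtain U where "open U" "0 \<in> U" "\<And>\<theta>. \<theta> \<in> U \<Longrightarrow> moment_gen M (X 1) \<theta> < \<infinity>"
      using X_mgf unfolding eventually_nhds by blast
    then show "0 \<in> interior (effective_domain ?\<Lambda>)"
      unfolding effective_domain_Lambda_frac by (intro interiorI[of U]) auto
  next
    fix \<theta> assume "?\<Lambda> \<theta> < \<infinity>"
    then have fin: "moment_gen M (X 1) \<theta> < \<infinity>" by (simp only: Lambda_frac_finite_iff)
    define c where "c = lam * (enn2real (moment_gen M (X 1) \<theta>) - 1)"
    note key = key[OF fin c_def]
    show "\<forall>\<^sub>F t in at_top. integrable M (\<lambda>\<omega>. exp (\<theta> * S t \<omega>))"
      using eventually_ge_at_top[of 0] by eventually_elim (use key in blast)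
    let ?ES = "\<lambda>t. ln (expectation (\<lambda>\<omega>. exp (\<theta> * S t \<omega>)))"
    let ?EL = "\<lambda>t. ln (expectation (\<lambda>\<omega>. exp (c * L t \<omega>)))"
    have near: "?EL t / t - \<bar>c\<bar> / t \<le> ?ES t / t \<and> ?ES t / t \<le> ?EL t / t + \<bar>c\<bar> / t" if "0 < t" for t
    proof -
      have pos: "0 < expectation (\<lambda>\<omega>. exp (c * L t \<omega>))" "0 < expectation (\<lambda>\<omega>. exp (\<theta> * S t \<omega>))"
        using key[of t] inverse_stable_exp_integrable[OF L \<open>0 < \<nu>\<close>] that
        by (auto intro!: expectation_exp_pos)
      have "ln (exp (- \<bar>c\<bar>) * expectation (\<lambda>\<omega>. exp (c * L t \<omega>))) \<le> ?ES t"
        "?ES t \<le> ln (exp \<bar>c\<bar> * expectation (\<lambda>\<omega>. exp (c * L t \<omega>)))"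
        using key[of t] pos that by simp_all
      then have "?EL t - \<bar>c\<bar> \<le> ?ES t" "?ES t \<le> ?EL t + \<bar>c\<bar>"
        using pos by (simp_all add: ln_mult)
      then show ?thesis
        using that unfolding diff_divide_distrib[symmetric] add_divide_distrib[symmetric]
        by (auto intro: divide_right_mono)
    qed
    have lim: "((\<lambda>t. ?EL t / t) \<longlongrightarrow> real_of_ereal (?\<Lambda> \<theta>)) at_top"
      using inverse_stable_cumulant_limit[OF L \<open>0 < \<nu>\<close> \<open>\<nu> < 1\<close>, of c]
      unfolding real_Lambda_frac[OF fin \<open>0 < lam\<close>] c_def .
    have c0: "((\<lambda>t. \<bar>c\<bar> / t) \<longlongrightarrow> 0) at_top" by real_asymp
    show "((\<lambda>t. ?ES t / t) \<longlongrightarrow> real_of_ereal (?\<Lambda> \<theta>)) at_top"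
    proof (rule tendsto_sandwich)
      show "\<forall>\<^sub>F t in at_top. ?EL t / t - \<bar>c\<bar> / t \<le> ?ES t / t"
        "\<forall>\<^sub>F t in at_top. ?ES t / t \<le> ?EL t / t + \<bar>c\<bar> / t"
        using near by (auto intro: eventually_mono[OF eventually_gt_at_top[of 0]])
      show "((\<lambda>t. ?EL t / t - \<bar>c\<bar> / t) \<longlongrightarrow> real_of_ereal (?\<Lambda> \<theta>)) at_top"
        using tendsto_diff[OF lim c0] by simp
      show "((\<lambda>t. ?EL t / t + \<bar>c\<bar> / t) \<longlongrightarrow> real_of_ereal (?\<Lambda> \<theta>)) at_top"
        using tendsto_add[OF lim c0] by simp
    qed
  qed
qed

end
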